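(* Let $A \in \mathbb{C}^{m\times n}$ be a tall matrix ($m \ge n \ge 2$) with singular values $\sigma_1 \ge \cdots \ge \sigma_n > 0$, and let $S \in \mathbb{C}^{d\times m}$ be a subspace embedding for $A$ with distortion $\eta \in [0,1)$. Define $$\mathrm{gap} := \frac{\sigma_{n-1}^2 - \sigma_n^2}{\sigma_n^2},$$ and suppose that $$\eta < \frac{\mathrm{gap}}{2+\mathrm{gap}}.$$ Let $v_{\min}$ be a unit right singular vector of $A$ corresponding to the smallest singular value $\sigma_n$, and for each integer $k \ge 0$ let $v_k$ be the vector produced after $k$ iterations of RLOBPCG run on $A$ with embedding $S$. Then $$\frac{\|A v_k\|^2 - \sigma_n^2}{\sigma_n^2} \le C \cdot \mathrm{gap} \cdot q^{2k},$$ $$|\sin \measuredangle (v_k, v_{\min})| \le |\tan \measuredangle (v_k, v_{\min})| \le C^{1/2} \cdot q^k,$$ where $$C = \frac{2\eta}{(1-\eta)\,\mathrm{gap} - 2\eta}, \qquad q = \eta + \frac{1-\eta}{1+\mathrm{gap}}.$$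
   Context: $\|\cdot\|$ is the Euclidean norm, $^*$ is the conjugate transpose, and $e_n$ is the $n$th standard basis vector of $\mathbb{C}^n$. For unit vectors $v, v_{\min}$, the angle is defined by $|\cos\measuredangle(v,v_{\min})| = |v_{\min}^* v|$. Subspace embedding: a matrix $S \in \mathbb{C}^{d\times m}$ is a subspace embedding for $A \in \mathbb{C}^{m\times n}$ with distortion $\eta$ if $$(1-\eta)\|Ay\|^2 \le \|SAy\|^2 \le (1+\eta)\|Ay\|^2 \quad \text{for all } y \in \mathbb{C}^n.$$ RLOBPCG (single-vector version, in exact arithmetic), given $A$ and $S$: 1. Compute an economy-size singular value decomposition $SA = U\Sigma V^*$, with $V \in \mathbb{C}^{n\times n}$ unitary and $\Sigma \in \mathbb{R}^{n\times n}$ diagonal with diagonal entries in nonincreasing order (all positive in the present setting). 2. Set $P := V\Sigma^{-1}$ and $v_0 = v_{-1} := P e_n/\|P e_n\|$. 3. For $i = 0,1,2,\ldots$: set $$w_i := P\big(P^*\big(A^*(A v_i) - \|A v_i\|^2 v_i\big)\big),$$ and let $v_{i+1}$ be a minimizer of $\|Az\|$ over all $z \in \mathrm{span}\{v_{i-1}, v_i, w_i\}$ with $\|z\| = 1$. The vector after $k$ iterations is $v_k$. *)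

theory Defs
  imports "HOL-Analysis.L2_Norm" "Jordan_Normal_Form.Schur_Decomposition" "Jordan_Normal_Form.VS_Connect"
begin

definition vnorm :: "complex vec \<Rightarrow> real" where
  "vnorm v = L2_set (\<lambda>i. cmod (v $ i)) {..<dim_vec v}"

definition subspace_embedding :: "complex mat \<Rightarrow> complex mat \<Rightarrow> real \<Rightarrow> bool" where
  "subspace_embedding S A \<eta> \<longleftrightarrow>
     (\<forall>y \<in> carrier_vec (dim_col A).
        (1 - \<eta>) * (vnorm (A *\<^sub>v y))\<^sup>2 \<le> (vnorm ((S * A) *\<^sub>v y))\<^sup>2 \<and>
        (vnorm ((S * A) *\<^sub>v y))\<^sup>2 \<le> (1 + \<eta>) * (vnorm (A *\<^sub>v y))\<^sup>2)"

text \<open>Singular values are numbered from 1, so that \<open>s 1, \<dots>, s n\<close> match the mathematical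
  \<open>\<sigma>\<^sub>1, \<dots>, \<sigma>\<^sub>n\<close>, whereas matrix and vector entries are numbered from 0; the values of \<open>s\<close>
  outside \<open>{1..n}\<close> are irrelevant.\<close>

definition real_diag :: "nat \<Rightarrow> (nat \<Rightarrow> real) \<Rightarrow> complex mat" where
  "real_diag n s = mat_diag n (\<lambda>i. complex_of_real (s (Suc i)))"

text \<open>For the square matrix \<open>V\<close> the condition \<open>V\<^sup>*V = I\<close> is unitarity; for the rectangular
  matrix \<open>U\<close> the condition \<open>U\<^sup>*U = I\<close> says that its columns are orthonormal.\<close>

definition economy_svd ::
  "complex mat \<Rightarrow> complex mat \<Rightarrow> (nat \<Rightarrow> real) \<Rightarrow> complex mat \<Rightarrow> bool" where
  "economy_svd M U s V \<longleftrightarrow>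
     (let n = dim_col M in
        U \<in> carrier_mat (dim_row M) n \<and> mat_adjoint U * U = 1\<^sub>m n \<and>
        V \<in> carrier_mat n n \<and> mat_adjoint V * V = 1\<^sub>m n \<and>
        (\<forall>i \<in> {1..n}. 0 \<le> s i) \<and> (\<forall>i \<in> {1..<n}. s (Suc i) \<le> s i) \<and>
        M = U * real_diag n s * mat_adjoint V)"

definition singular_values :: "complex mat \<Rightarrow> (nat \<Rightarrow> real) \<Rightarrow> bool" where
  "singular_values M s \<longleftrightarrow> (\<exists>U V. economy_svd M U s V)"

definition unit_right_singular_vector :: "complex mat \<Rightarrow> real \<Rightarrow> complex vec \<Rightarrow> bool" where
  "unit_right_singular_vector M t v \<longleftrightarrow>
     v \<in> carrier_vec (dim_col M) \<and> vnorm v = 1 \<and>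
     (\<exists>u \<in> carrier_vec (dim_row M). vnorm u = 1 \<and>
        M *\<^sub>v v = complex_of_real t \<cdot>\<^sub>v u \<and> mat_adjoint M *\<^sub>v u = complex_of_real t \<cdot>\<^sub>v v)"

text \<open>\<open>v \<bullet>c w\<close> is \<open>w\<^sup>* v\<close>. Among the angles with \<open>\<bar>cos \<theta>\<bar> = \<bar>w\<^sup>* v\<bar>\<close> we take the one in
  \<open>[0, \<pi>/2]\<close>; absolute values of sine and tangent do not depend on that choice.
  Since \<open>tan (\<pi>/2) = 0\<close> in HOL, a bound on \<open>\<bar>tan\<bar>\<close> alone would not exclude orthogonal
  vectors, but \<open>\<bar>sin\<bar> \<le> \<bar>tan\<bar>\<close> does.\<close>

definition vangle :: "complex vec \<Rightarrow> complex vec \<Rightarrow> real" where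
  "vangle v w = arccos (cmod (v \<bullet>c w))"

definition cspan :: "nat \<Rightarrow> complex vec set \<Rightarrow> complex vec set" where
  "cspan n X = LinearCombinations.module.span class_ring (module_vec TYPE(complex) n) X"

definition rlobpcg_direction :: "complex mat \<Rightarrow> complex mat \<Rightarrow> complex vec \<Rightarrow> complex vec" where
  "rlobpcg_direction A P x =
     P *\<^sub>v (mat_adjoint P *\<^sub>v
       (mat_adjoint A *\<^sub>v (A *\<^sub>v x) - complex_of_real ((vnorm (A *\<^sub>v x))\<^sup>2) \<cdot>\<^sub>v x))"

text \<open>\<open>v\<close> is a possible sequence of iterates (the singular value decomposition and the
  minimizers need not be unique). The matrix \<open>real_diag n (\<lambda>i. 1 / s i)\<close> is \<open>\<Sigma>\<^sup>-\<^sup>1\<close> when the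
  singular values of \<open>S * A\<close> are positive. The last standard basis vector \<open>e\<^sub>n\<close> is
  \<open>unit_vec n (n - 1)\<close>. Because \<open>0 - 1 = 0\<close> on the naturals, \<open>v (i - 1)\<close> is \<open>v 0\<close> for
  \<open>i = 0\<close>, which is the convention \<open>v\<^sub>-\<^sub>1 = v\<^sub>0\<close>.\<close>

definition rlobpcg :: "complex mat \<Rightarrow> complex mat \<Rightarrow> (nat \<Rightarrow> complex vec) \<Rightarrow> bool" where
  "rlobpcg A S v \<longleftrightarrow>
     (\<exists>U s V. economy_svd (S * A) U s V \<and>
       (let n = dim_col A;
            P = V * real_diag n (\<lambda>i. 1 / s i);
            p = P *\<^sub>v unit_vec n (n - 1)
        in v 0 = complex_of_real (1 / vnorm p) \<cdot>\<^sub>v p \<and>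
           (\<forall>i. is_arg_min (\<lambda>z. vnorm (A *\<^sub>v z))
                  (\<lambda>z. z \<in> cspan n {v (i - 1), v i, rlobpcg_direction A P (v i)} \<and> vnorm z = 1)
                  (v (Suc i)))))"

end

theory Submission
  imports Defs "HOL-Analysis.Inner_Product"
begin

text \<open>In the coordinates \<open>y = \<Sigma> V\<^sup>* x\<close> of the singular value decomposition of \<open>A\<close>, the reciprocal of
  \<open>\<parallel>A x\<parallel>\<^sup>2 / \<parallel>x\<parallel>\<^sup>2\<close> is the Rayleigh quotient \<open>\<mu>\<close> of the diagonal matrix \<open>B\<close> with entries
  \<open>1 / \<sigma>\<^sub>i\<^sup>2\<close>. The embedding property says that the preconditioner \<open>P P\<^sup>*\<close>, suitably scaled, changes
  the residual \<open>r = B y - \<mu> y\<close> of a unit vector by at most \<open>\<eta> \<parallel>r\<parallel>\<close>, so the search space contains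
  a vector \<open>p\<close> with \<open>\<parallel>p - B y\<parallel> \<le> \<eta> \<parallel>r\<parallel>\<close>.

  By the Cauchy-Schwarz inequality every vector in the cone around \<open>B y\<close> whose boundary contains
  \<open>y\<close> has Rayleigh quotient at least \<open>\<mu>\<close>. Since \<open>p\<close> lies in a narrower cone, it can be rotated away
  from the dominant eigenvector by the difference of the opening angles before its quotient drops
  to \<open>\<mu>\<close>. As \<open>\<parallel>r\<parallel>\<close> is smallest when \<open>y\<close> lies in the plane of the two leading eigenvectors,
  this yields the contraction by \<open>q\<^sup>2\<close> of \<open>(\<rho> - \<sigma>\<^sub>n\<^sup>2) / (\<sigma>\<^sub>n\<^sub>-\<^sub>1\<^sup>2 - \<rho>)\<close> for \<open>\<rho> = \<parallel>A v\<parallel>\<^sup>2\<close>,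
  which starts below \<open>C\<close> by the embedding property and bounds the squared tangent of the angle.\<close>

section \<open>Weighted inner products\<close>

text \<open>With complex entries, viewed as a real inner product space, this is the real part of a
  weighted Hermitian form. The rotation argument only forms real combinations of vectors, so the
  real part suffices.\<close>

definition wip :: "'i set \<Rightarrow> ('i \<Rightarrow> real) \<Rightarrow> ('i \<Rightarrow> 'v::real_inner) \<Rightarrow> ('i \<Rightarrow> 'v) \<Rightarrow> real" where
  "wip I w f g = (\<Sum>i\<in>I. w i * inner (f i) (g i))"

lemma wip_commute: "wip I w f g = wip I w g f"
  by (simp add: wip_def inner_commute)

lemma wip_lin_left:
  "wip I w (\<lambda>i. s *\<^sub>R f i + t *\<^sub>R g i) h = s * wip I w f h + t * wip I w g h"
  by (simp add: wip_def inner_add_left sum.distrib sum_distrib_left algebra_simps)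

lemma wip_lin_right:
  "wip I w h (\<lambda>i. s *\<^sub>R f i + t *\<^sub>R g i) = s * wip I w h f + t * wip I w h g"
  by (simp add: wip_commute[of I w h] wip_lin_left)

lemma wip_lin_self:
  "wip I w (\<lambda>i. s *\<^sub>R f i + t *\<^sub>R g i) (\<lambda>i. s *\<^sub>R f i + t *\<^sub>R g i)
   = s\<^sup>2 * wip I w f f + 2 * s * t * wip I w f g + t\<^sup>2 * wip I w g g"
  by (simp add: wip_lin_left wip_lin_right wip_commute[of I w g f] power2_eq_square algebra_simps)

lemma wip_cong:
  "(\<And>i. i \<in> I \<Longrightarrow> w i * inner (f i) (g i) = w' i * inner (f' i) (g' i)) \<Longrightarrow> wip I w f g = wip I w' f' g'"
  unfolding wip_def by (rule sum.cong) auto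

lemma wip_self: "wip I w f f = (\<Sum>i\<in>I. w i * (norm (f i))\<^sup>2)"
  by (simp add: wip_def power2_norm_eq_inner)

lemma wip_nonneg: "(\<And>i. i \<in> I \<Longrightarrow> 0 \<le> w i) \<Longrightarrow> 0 \<le> wip I w f f"
  by (simp add: wip_def sum_nonneg)

text \<open>Scaling entry \<open>i\<close> by \<open>sqrt (w i)\<close> reduces the claim to the
  unweighted inequality for the norms of the entries.\<close>

lemma wip_Cauchy_Schwarz:
  assumes w: "\<And>i. i \<in> I \<Longrightarrow> 0 \<le> w i"
  shows "(wip I w f g)\<^sup>2 \<le> wip I w f f * wip I w g g"
proof -
  have "\<bar>wip I w f g\<bar> \<le> (\<Sum>i\<in>I. \<bar>w i * inner (f i) (g i)\<bar>)"
    unfolding wip_def by (rule sum_abs)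
  also have "\<dots> \<le> (\<Sum>i\<in>I. \<bar>sqrt (w i) * norm (f i)\<bar> * \<bar>sqrt (w i) * norm (g i)\<bar>)"
  proof (rule sum_mono)
    fix i assume i: "i \<in> I"
    have "\<bar>w i * inner (f i) (g i)\<bar> \<le> w i * (norm (f i) * norm (g i))"
      using w[OF i] Cauchy_Schwarz_ineq2[of "f i" "g i"] by (simp add: abs_mult mult_left_mono)
    also have "\<dots> = (sqrt (w i))\<^sup>2 * (norm (f i) * norm (g i))" using w[OF i] by simp
    finally show "\<bar>w i * inner (f i) (g i)\<bar>
        \<le> \<bar>sqrt (w i) * norm (f i)\<bar> * \<bar>sqrt (w i) * norm (g i)\<bar>"
      using w[OF i] by (simp only: power2_eq_square abs_mult abs_norm_cancel real_sqrt_abs abs_of_nonneg real_sqrt_ge_zero ac_simps)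
  qed
  also have "\<dots> \<le> L2_set (\<lambda>i. sqrt (w i) * norm (f i)) I * L2_set (\<lambda>i. sqrt (w i) * norm (g i)) I"
    by (rule L2_set_mult_ineq)
  finally have "(wip I w f g)\<^sup>2 \<le> (L2_set (\<lambda>i. sqrt (w i) * norm (f i)) I * L2_set (\<lambda>i. sqrt (w i) * norm (g i)) I)\<^sup>2"
    by (metis abs_ge_zero power2_abs power_mono)
  also have "\<dots> = wip I w f f * wip I w g g"
  proof -
    have "(L2_set (\<lambda>i. sqrt (w i) * norm (f i)) I)\<^sup>2 = wip I w f f" for f :: "'a \<Rightarrow> 'b"
      using w by (simp add: L2_set_def wip_def sum_nonneg power_mult_distrib dot_square_norm)
    thus ?thesis by (simp add: power_mult_distrib)
  qed
  finally show ?thesis .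
qed

text \<open>\<open>X\<close> and \<open>Y\<close> are the coordinates of the projection of
  \<open>b\<close> to the plane of \<open>p\<close> and \<open>g\<close>; the squared distance of
  \<open>b\<close> from that projection is nonnegative.\<close>

lemma wip_Bessel:
  assumes "wip I (\<lambda>_. 1) p p = 1" "wip I (\<lambda>_. 1) g g = 1" "wip I (\<lambda>_. 1) p g = 0"
  shows "(wip I (\<lambda>_. 1) p b)\<^sup>2 + (wip I (\<lambda>_. 1) g b)\<^sup>2 \<le> wip I (\<lambda>_. 1) b b"
proof -
  define X Y where "X = wip I (\<lambda>_. 1) p b" and "Y = wip I (\<lambda>_. 1) g b"
  let ?z = "\<lambda>i. X *\<^sub>R p i + Y *\<^sub>R g i"
  have "0 \<le> wip I (\<lambda>_. 1) (\<lambda>i. 1 *\<^sub>R b i + (-1) *\<^sub>R ?z i) (\<lambda>i. 1 *\<^sub>R b i + (-1) *\<^sub>R ?z i)"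
    by (rule wip_nonneg) simp
  also have "\<dots> = wip I (\<lambda>_. 1) b b - (X\<^sup>2 + Y\<^sup>2)"
    using assms
    by (simp only: wip_lin_self wip_lin_right wip_commute[of I _ b p] wip_commute[of I _ b g]
        X_def[symmetric] Y_def[symmetric]) (simp add: power2_eq_square)
  finally show ?thesis by (simp add: X_def Y_def)
qed

text \<open>Here \<open>\<tau>\<close> and \<open>\<tau>'\<close> are tangents of angles whose difference has tangent \<open>h\<close>. The hypotheses on
  \<open>\<mu>\<close> and \<open>R\<close> describe a vector at the angle with tangent \<open>\<tau>\<close> to the dominant eigenvector: its
  Rayleigh quotient in the plane case, and a lower bound for the norm of its residual.\<close>

lemma rotation_bound:
  fixes \<mu>1 \<mu>2 \<eta> \<tau> \<tau>' R \<mu> h q :: real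
  assumes "0 < \<mu>2" "\<mu>2 < \<mu>1" "0 \<le> \<eta>" "\<eta> < 1" "0 < \<tau>" "q * \<tau> < \<tau>'" "\<tau>' \<le> \<tau>"
    and q: "q = \<eta> + (1 - \<eta>) * (\<mu>2 / \<mu>1)"
    and \<mu>: "\<mu> * (1 + \<tau>\<^sup>2) = \<mu>1 + \<mu>2 * \<tau>\<^sup>2"
    and R: "(\<mu>1 - \<mu>2) * \<tau> \<le> R * (1 + \<tau>\<^sup>2)"
    and h: "h * (1 + \<tau> * \<tau>') = \<tau> - \<tau>'"
  shows "0 \<le> h" "\<mu> * h + \<eta> * R * sqrt (1 + h\<^sup>2) < R"
proof -
  \<comment> \<open>The residual norm in the plane case: \<open>\<mu>1 - \<mu>2\<close> times sine
    times cosine. The estimate is proved for \<open>R0\<close> first and then carried over to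
    \<open>R\<close>.\<close>
  define R0 where "R0 = (\<mu>1 - \<mu>2) * \<tau> / (1 + \<tau>\<^sup>2)"
  have q0: "0 \<le> q" using assms by simp
  have t'0: "0 \<le> \<tau>'" using q0 assms(5,6) by (meson less_le_not_le mult_nonneg_nonneg order_trans)
  have p1: "0 < 1 + \<tau> * \<tau>'" using t'0 assms(5) by (simp add: add_pos_nonneg)
  have p2: "0 < 1 + \<tau>\<^sup>2" by (simp add: add_pos_nonneg)
  have hq: "h = (\<tau> - \<tau>') / (1 + \<tau> * \<tau>')" using h p1 by (simp add: field_simps)
  show h0: "0 \<le> h" using hq p1 assms(7) by simp
  have R0R: "R0 \<le> R" using R p2 by (simp add: R0_def field_simps)
  have R0p: "0 < R0" using assms p2 by (simp add: R0_def)
  define w where "w = sqrt (1 + \<tau>'\<^sup>2)"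
  define u where "u = sqrt (1 + \<tau>\<^sup>2)"
  have u2: "u\<^sup>2 = 1 + \<tau>\<^sup>2" by (simp add: u_def)
  have u0: "0 < u" using p2 by (simp add: u_def)
  have wu: "w \<le> u" "0 \<le> w" using assms(7) t'0 by (simp_all add: w_def u_def power_mono)
  \<comment> \<open>\<open>u\<close>, \<open>w\<close> and \<open>sqrt (1 + h\<^sup>2)\<close> are
    the secants of the two angles and of their difference; this is the subtraction formula for the
    cosine.\<close>
  have "1 + h\<^sup>2 = (1 + \<tau>\<^sup>2) * (1 + \<tau>'\<^sup>2) / (1 + \<tau> * \<tau>')\<^sup>2"
    unfolding hq using p1 by (simp add: power_divide field_simps) (simp add: power2_eq_square algebra_simps)
  hence sh: "sqrt (1 + h\<^sup>2) = u * w / (1 + \<tau> * \<tau>')"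
    using p1 by (simp add: real_sqrt_divide real_sqrt_mult u_def w_def)
  \<comment> \<open>The form of \<open>q\<close> enters here: multiplying
    \<open>q * \<tau> < \<tau>'\<close> by \<open>\<mu>1\<close> clears its quotient.\<close>
  have "\<eta> * (\<mu>1 - \<mu>2) * \<tau> < \<mu>1 * \<tau>' - \<mu>2 * \<tau>"
  proof -
    have "\<mu>1 * (q * \<tau>) < \<mu>1 * \<tau>'" using assms by simp
    moreover have "\<mu>1 * q = \<eta> * \<mu>1 + (1 - \<eta>) * \<mu>2" using assms by (simp add: q field_simps)
    ultimately have "(\<eta> * \<mu>1 + (1 - \<eta>) * \<mu>2) * \<tau> < \<mu>1 * \<tau>'" by (metis mult.assoc)
    thus ?thesis by (simp add: algebra_simps)
  qed
  moreover have "0 \<le> \<eta> * (\<mu>1 - \<mu>2) * \<tau>" using assms by simp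
  ultimately have "\<eta> * (\<mu>1 - \<mu>2) * \<tau> * w < (\<mu>1 * \<tau>' - \<mu>2 * \<tau>) * u"
    using wu u0 by (meson le_less_trans mult_left_mono mult_strict_right_mono)
  hence "u * (\<eta> * (\<mu>1 - \<mu>2) * \<tau> * w) < u * ((\<mu>1 * \<tau>' - \<mu>2 * \<tau>) * u)" using u0 by simp
  also have "\<dots> = (\<mu>1 * \<tau>' - \<mu>2 * \<tau>) * (1 + \<tau>\<^sup>2)" unfolding u2[symmetric] by (simp add: power2_eq_square)
  \<comment> \<open>The result is the numerator of \<open>R0 - \<mu> * h\<close> over the common
    denominator \<open>(1 + \<tau>\<^sup>2) * (1 + \<tau> * \<tau>')\<close>.\<close>
  also have "\<dots> = (\<mu>1 - \<mu>2) * \<tau> * (1 + \<tau> * \<tau>') - (\<mu>1 + \<mu>2 * \<tau>\<^sup>2) * (\<tau> - \<tau>')"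
    by (simp add: power2_eq_square algebra_simps)
  finally have 1: "\<eta> * (\<mu>1 - \<mu>2) * \<tau> * u * w < (\<mu>1 - \<mu>2) * \<tau> * (1 + \<tau> * \<tau>') - (\<mu>1 + \<mu>2 * \<tau>\<^sup>2) * (\<tau> - \<tau>')"
    by (simp add: algebra_simps)
  have "\<mu> * h + \<eta> * R0 * sqrt (1 + h\<^sup>2) < R0"
  proof -
    have m: "\<mu> = (\<mu>1 + \<mu>2 * \<tau>\<^sup>2) / (1 + \<tau>\<^sup>2)" using \<mu> p2 by (simp add: field_simps)
    have "R0 - \<mu> * h - \<eta> * R0 * sqrt (1 + h\<^sup>2)
      = ((\<mu>1 - \<mu>2) * \<tau> * (1 + \<tau> * \<tau>') - (\<mu>1 + \<mu>2 * \<tau>\<^sup>2) * (\<tau> - \<tau>') - \<eta> * (\<mu>1 - \<mu>2) * \<tau> * u * w)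
        / ((1 + \<tau>\<^sup>2) * (1 + \<tau> * \<tau>'))"
    proof -
      have e: "a / d - m / d * (x / e) - \<eta> * (a / d) * (y / e) = (a * e - m * x - \<eta> * a * y) / (d * e)"
        if "d \<noteq> 0" "e \<noteq> 0" for a d m x e y :: real
        using that by (simp add: field_simps)
      show ?thesis unfolding sh unfolding R0_def m hq using p1 p2 by (subst e) (auto simp: mult.assoc)
    qed
    also have "\<dots> > 0" using 1 p1 p2 by simp
    finally show ?thesis by simp
  qed
  \<comment> \<open>As \<open>\<mu> * h\<close> is nonnegative, the inequality for \<open>R0\<close>
    forces \<open>1 - \<eta> * sqrt (1 + h\<^sup>2)\<close> to be positive, and so it survives the
    increase from \<open>R0\<close> to \<open>R\<close>.\<close>
  moreover have "0 \<le> \<mu> * h"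
  proof -
    have "0 < \<mu> * (1 + \<tau>\<^sup>2)" unfolding \<mu> using assms by (simp add: add_pos_nonneg)
    hence "0 < \<mu>" using p2 by (simp add: zero_less_mult_iff)
    thus ?thesis using h0 by simp
  qed
  ultimately have "0 < R0 * (1 - \<eta> * sqrt (1 + h\<^sup>2))" by (simp add: algebra_simps)
  hence "0 < 1 - \<eta> * sqrt (1 + h\<^sup>2)" using R0p by (simp add: zero_less_mult_iff)
  hence "R0 * (1 - \<eta> * sqrt (1 + h\<^sup>2)) \<le> R * (1 - \<eta> * sqrt (1 + h\<^sup>2))" using R0R by simp
  thus "\<mu> * h + \<eta> * R * sqrt (1 + h\<^sup>2) < R"
    using \<open>\<mu> * h + \<eta> * R0 * sqrt (1 + h\<^sup>2) < R0\<close> by (simp add: algebra_simps)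
qed

section \<open>Contraction of a preconditioned step\<close>

text \<open>The diagonal matrix \<open>B\<close> through its dominant entry and an upper bound for
  the others; the latter may be spread anywhere in \<open>[0, \<mu>2]\<close>.\<close>

locale dominant_weight =
  fixes I :: "'i set" and i0 :: 'i and \<beta> :: "'i \<Rightarrow> real" and \<mu>1 \<mu>2 :: real
  assumes fin: "finite I" and i0: "i0 \<in> I" and \<beta>_i0: "\<beta> i0 = \<mu>1"
    and \<beta>_le: "\<And>i. i \<in> I \<Longrightarrow> i \<noteq> i0 \<Longrightarrow> \<beta> i \<le> \<mu>2"
    and \<beta>_nonneg: "\<And>i. i \<in> I \<Longrightarrow> 0 \<le> \<beta> i"
    and \<mu>2_pos: "0 < \<mu>2" and \<mu>2_less: "\<mu>2 < \<mu>1"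
begin

lemma wip_split:
  "wip I w f g = w i0 * inner (f i0) (g i0) + wip (I - {i0}) w f g"
  unfolding wip_def using fin i0 by (simp add: sum.remove)

lemma wip_le_first: "wip I \<beta> f f \<le> \<mu>1 * wip I (\<lambda>_. 1) f f"
proof -
  have "\<beta> i \<le> \<mu>1" if "i \<in> I" for i using \<beta>_le[OF that] \<beta>_i0 \<mu>2_less by (cases "i = i0") auto
  thus ?thesis unfolding wip_def sum_distrib_left by (intro sum_mono) (auto intro: mult_right_mono)
qed

text \<open>Used to show that a vector with a large Rayleigh quotient has a large component at
  \<open>i0\<close>.\<close>

lemma wip_le_second:
  "wip I \<beta> f f \<le> \<mu>1 * (norm (f i0))\<^sup>2 + \<mu>2 * (wip I (\<lambda>_. 1) f f - (norm (f i0))\<^sup>2)"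
proof -
  have "wip (I - {i0}) \<beta> f f \<le> \<mu>2 * wip (I - {i0}) (\<lambda>_. 1) f f"
    unfolding wip_def sum_distrib_left using \<beta>_le by (intro sum_mono) (auto intro: mult_right_mono)
  thus ?thesis by (simp add: wip_split[of \<beta>] wip_split[of "\<lambda>_. 1"] \<beta>_i0 dot_square_norm)
qed

text \<open>No weight lies strictly between \<open>\<mu>2\<close> and \<open>\<mu>1\<close>, so
  \<open>(\<beta> i - \<mu>1) * (\<beta> i - \<mu>2)\<close> is nonnegative; average it with the
  squared entries of \<open>y\<close>. The right-hand side is the squared residual norm, and
  equality holds if \<open>y\<close> lives on the weights \<open>\<mu>1\<close> and
  \<open>\<mu>2\<close>.\<close>

lemma variance_bound:
  assumes "wip I (\<lambda>_. 1) y y = 1"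
  shows "(\<mu>1 - wip I \<beta> y y) * (wip I \<beta> y y - \<mu>2) \<le> wip I (\<lambda>i. (\<beta> i)\<^sup>2) y y - (wip I \<beta> y y)\<^sup>2"
proof -
  have "0 \<le> (\<Sum>i\<in>I. (\<beta> i - \<mu>1) * (\<beta> i - \<mu>2) * inner (y i) (y i))"
  proof (rule sum_nonneg)
    fix i assume i: "i \<in> I"
    have "0 \<le> (\<beta> i - \<mu>1) * (\<beta> i - \<mu>2)"
      using \<beta>_le[OF i] \<beta>_i0 \<mu>2_less by (cases "i = i0") (auto simp: mult_nonpos_nonpos)
    thus "0 \<le> (\<beta> i - \<mu>1) * (\<beta> i - \<mu>2) * inner (y i) (y i)" by simp
  qed
  also have "\<dots> = wip I (\<lambda>i. (\<beta> i)\<^sup>2) y y - (\<mu>1 + \<mu>2) * wip I \<beta> y y + \<mu>1 * \<mu>2 * wip I (\<lambda>_. 1) y y"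
    unfolding wip_def sum_distrib_left sum.distrib[symmetric] sum_subtractf[symmetric]
    by (rule sum.cong) (simp_all add: power2_eq_square algebra_simps)
  finally show ?thesis using assms by (simp add: power2_eq_square algebra_simps)
qed

text \<open>If \<open>p\<close> were too far from the coordinate \<open>i0\<close>, rotate it away from \<open>i0\<close>, within the plane of its
  \<open>i0\<close> and remaining components, until the Rayleigh quotient is at most \<open>\<mu>\<close>. The rotated
  vector \<open>z\<close> is still so close to \<open>\<beta> y\<close> that the Cauchy-Schwarz inequality makes its quotient
  exceed \<open>\<mu>\<close>. If all \<open>\<beta> i\<close> with \<open>i \<noteq> i0\<close> equal \<open>\<mu>2\<close>, the angle is exactly that of
  \<open>rotation_bound\<close>; smaller weights only help.\<close>

lemma rotation_step:
  fixes y p :: "'i \<Rightarrow> 'v::real_inner"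
  assumes ny: "wip I (\<lambda>_. 1) y y = 1" and np: "wip I (\<lambda>_. 1) p p = 1"
    and \<mu>: "\<mu> = wip I \<beta> y y" and \<mu>': "\<mu>' = wip I \<beta> p p"
    and gt: "\<mu>2 < \<mu>" and \<eta>: "0 \<le> \<eta>" "\<eta> < 1"
    and q: "q = \<eta> + (1 - \<eta>) * (\<mu>2 / \<mu>1)"
    and X0: "0 \<le> wip I \<beta> p y"
    and X2: "\<mu>\<^sup>2 + (1 - \<eta>\<^sup>2) * (wip I (\<lambda>i. (\<beta> i)\<^sup>2) y y - \<mu>\<^sup>2) \<le> (wip I \<beta> p y)\<^sup>2"
  shows "\<mu> \<le> \<mu>'" "(\<mu>1 - \<mu>') * (\<mu> - \<mu>2) \<le> q\<^sup>2 * ((\<mu>1 - \<mu>) * (\<mu>' - \<mu>2))"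
proof -
  define R where "R = sqrt (wip I (\<lambda>i. (\<beta> i)\<^sup>2) y y - \<mu>\<^sup>2)"
  define X where "X = wip I \<beta> p y"
  have \<mu>le: "\<mu> \<le> \<mu>1" and \<mu>'le: "\<mu>' \<le> \<mu>1"
    using wip_le_first[of y] wip_le_first[of p] ny np by (simp_all add: \<mu> \<mu>')
  have var: "(\<mu>1 - \<mu>) * (\<mu> - \<mu>2) \<le> wip I (\<lambda>i. (\<beta> i)\<^sup>2) y y - \<mu>\<^sup>2"
    using variance_bound[OF ny] by (simp add: \<mu>)
  moreover have "0 \<le> (\<mu>1 - \<mu>) * (\<mu> - \<mu>2)" using \<mu>le gt by simp
  ultimately have v0: "0 \<le> wip I (\<lambda>i. (\<beta> i)\<^sup>2) y y - \<mu>\<^sup>2" by linarith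
  have R2: "R\<^sup>2 = wip I (\<lambda>i. (\<beta> i)\<^sup>2) y y - \<mu>\<^sup>2" and R0: "0 \<le> R" using v0 by (simp_all add: R_def)
  have \<mu>0: "0 < \<mu>" using gt \<mu>2_pos by simp
  have e1: "\<eta>\<^sup>2 \<le> 1" using \<eta> by (simp add: power_le_one)
  have X2': "\<mu>\<^sup>2 + (1 - \<eta>\<^sup>2) * R\<^sup>2 \<le> X\<^sup>2" using X2 by (simp add: R2 X_def)
  \<comment> \<open>Cauchy-Schwarz in the \<open>\<beta>\<close>-form gives
    \<open>\<mu>\<^sup>2 \<le> X\<^sup>2 \<le> \<mu>' * \<mu>\<close>.\<close>
  have "\<mu> * \<mu> \<le> X\<^sup>2" using X2' e1 by (smt (verit) mult_nonneg_nonneg power2_eq_square zero_le_power2)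
  also have "X\<^sup>2 \<le> \<mu>' * \<mu>" unfolding X_def \<mu> \<mu>' by (rule wip_Cauchy_Schwarz) (rule \<beta>_nonneg)
  finally show le: "\<mu> \<le> \<mu>'" using \<mu>0 by simp
  show "(\<mu>1 - \<mu>') * (\<mu> - \<mu>2) \<le> q\<^sup>2 * ((\<mu>1 - \<mu>) * (\<mu>' - \<mu>2))"
  proof (rule ccontr)
    assume neg: "\<not> ?thesis"
    define D where "D = \<mu>1 - \<mu>2"
    \<comment> \<open>A vector in the plane of the eigenvalues \<open>\<mu>1\<close> and
      \<open>\<mu>2\<close> with quotient \<open>\<mu>\<close> has this tangent to the dominant
      eigenvector; likewise \<open>\<tau>'\<close> for \<open>\<mu>'\<close>. The negated claim then
      reads \<open>q * \<tau> < \<tau>'\<close>.\<close>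
    define \<tau> where "\<tau> = sqrt ((\<mu>1 - \<mu>) / (\<mu> - \<mu>2))"
    define \<tau>' where "\<tau>' = sqrt ((\<mu>1 - \<mu>') / (\<mu>' - \<mu>2))"
    have D0: "0 < D" using \<mu>2_less by (simp add: D_def)
    have q0: "0 \<le> q" using \<eta> \<mu>2_pos \<mu>2_less by (simp add: q)
    have \<tau>2: "\<tau>\<^sup>2 = (\<mu>1 - \<mu>) / (\<mu> - \<mu>2)" and \<tau>'2: "\<tau>'\<^sup>2 = (\<mu>1 - \<mu>') / (\<mu>' - \<mu>2)"
      using \<mu>le \<mu>'le gt le by (simp_all add: \<tau>_def \<tau>'_def)
    have \<tau>0: "0 \<le> \<tau>" "0 \<le> \<tau>'" using \<mu>le \<mu>'le gt le by (simp_all add: \<tau>_def \<tau>'_def)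
    have "\<tau>'\<^sup>2 \<le> \<tau>\<^sup>2" unfolding \<tau>2 \<tau>'2 using gt le \<mu>'le by (intro frac_le) auto
    hence \<tau>le: "\<tau>' \<le> \<tau>" using power2_le_imp_le[OF _ \<tau>0(1)] by blast
    have "(q * \<tau>)\<^sup>2 < \<tau>'\<^sup>2"
    proof -
      have frac: "Q * (A / B) < E / F" if "Q * (A * F) < E * B" "0 < B" "0 < F" for Q A B E F :: real
        using that by (simp add: field_simps)
      show ?thesis unfolding power_mult_distrib \<tau>2 \<tau>'2 using neg gt le by (intro frac) auto
    qed
    hence q\<tau>: "q * \<tau> < \<tau>'" using power2_less_imp_less[OF _ \<tau>0(2)] by blast
    hence \<tau>'pos: "0 < \<tau>'" using q0 \<tau>0 by (smt (verit) mult_nonneg_nonneg)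
    hence \<tau>pos: "0 < \<tau>" using \<tau>le by simp
    have p1: "0 < 1 + \<tau> * \<tau>'" using \<tau>0 by (simp add: add_pos_nonneg)
    have pt: "0 < 1 + \<tau>\<^sup>2" "0 < 1 + \<tau>'\<^sup>2" by (simp_all add: add_pos_nonneg)
    have s: "(\<mu>1 - \<mu>) * (1 + \<tau>\<^sup>2) = D * \<tau>\<^sup>2" "(\<mu>1 - \<mu>') * (1 + \<tau>'\<^sup>2) = D * \<tau>'\<^sup>2"
       "(\<mu> - \<mu>2) * (1 + \<tau>\<^sup>2) = D" "(\<mu>' - \<mu>2) * (1 + \<tau>'\<^sup>2) = D"
      unfolding \<tau>2 \<tau>'2 D_def using gt le by (simp_all add: field_simps)
    define h where "h = (\<tau> - \<tau>') / (1 + \<tau> * \<tau>')"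
    have h: "h * (1 + \<tau> * \<tau>') = \<tau> - \<tau>'" using p1 by (simp add: h_def)
    have m: "\<mu> * (1 + \<tau>\<^sup>2) = \<mu>1 + \<mu>2 * \<tau>\<^sup>2" using s(3) by (simp add: D_def algebra_simps)
    have "(D * \<tau>)\<^sup>2 = ((\<mu>1 - \<mu>) * (1 + \<tau>\<^sup>2)) * ((\<mu> - \<mu>2) * (1 + \<tau>\<^sup>2))"
      unfolding s by (simp add: power2_eq_square)
    also have "\<dots> = (\<mu>1 - \<mu>) * (\<mu> - \<mu>2) * (1 + \<tau>\<^sup>2)\<^sup>2" by (simp add: power2_eq_square)
    also have "\<dots> \<le> R\<^sup>2 * (1 + \<tau>\<^sup>2)\<^sup>2" using var by (intro mult_right_mono) (simp_all add: R2)
    finally have "(D * \<tau>)\<^sup>2 \<le> (R * (1 + \<tau>\<^sup>2))\<^sup>2" by (simp add: power_mult_distrib)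
    hence DR: "(\<mu>1 - \<mu>2) * \<tau> \<le> R * (1 + \<tau>\<^sup>2)" unfolding D_def[symmetric]
      using R0 pt by (rule_tac power2_le_imp_le) auto
    note rot = rotation_bound[OF \<mu>2_pos \<mu>2_less \<eta> \<tau>pos q\<tau> \<tau>le q m DR h]
    \<comment> \<open>\<open>C1\<close> and \<open>sqrt S2\<close> are the cosine and sine of the
      true angle between \<open>p\<close> and the coordinate \<open>i0\<close>. Both must be
      positive for the cotangent \<open>k\<close> to be usable.\<close>
    define C1 where "C1 = norm (p i0)"
    define S2 where "S2 = wip (I - {i0}) (\<lambda>_. 1) p p"
    have CS: "C1\<^sup>2 + S2 = 1"
      using np wip_split[of "\<lambda>_. 1" p p] by (simp add: C1_def S2_def dot_square_norm)
    have C1D: "\<mu>' - \<mu>2 \<le> D * C1\<^sup>2"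
      using wip_le_second[of p] by (simp add: np C1_def D_def algebra_simps flip: \<mu>')
    moreover have "0 < \<mu>' - \<mu>2" using gt le by simp
    ultimately have "0 < D * C1\<^sup>2" by linarith
    hence C1: "0 < C1" using D0 by (simp add: zero_less_mult_iff C1_def)
    have \<mu>'less: "\<mu>' < \<mu>1" using \<tau>'pos \<mu>'le by (cases "\<mu>' = \<mu>1") (auto simp: \<tau>'_def)
    have split': "\<mu>' = \<mu>1 * C1\<^sup>2 + wip (I - {i0}) \<beta> p p"
      unfolding \<mu>' using wip_split[of \<beta> p p] by (simp add: \<beta>_i0 C1_def dot_square_norm)
    have "0 \<le> wip (I - {i0}) \<beta> p p" using \<beta>_nonneg by (intro wip_nonneg) auto
    hence "\<mu>1 * C1\<^sup>2 < \<mu>1 * 1" using split' \<mu>'less by simp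
    hence "C1\<^sup>2 < 1" using \<mu>2_pos \<mu>2_less by (simp add: mult_less_cancel_left_pos)
    hence S2: "0 < S2" using CS by simp
    define k where "k = C1 / sqrt S2"
    have k0: "0 < k" using C1 S2 by (simp add: k_def)
    have k2: "k\<^sup>2 * S2 = C1\<^sup>2" using S2 by (simp add: k_def power_divide)
    \<comment> \<open>The unit vector orthogonal to \<open>p\<close> in the plane of its
      \<open>i0\<close> component and the rest: the two components exchange their lengths, and one
      changes sign. Thus \<open>p + h g\<close> is \<open>p\<close> turned away from
      \<open>i0\<close> by the angle with tangent \<open>h\<close>, at length
      \<open>sqrt (1 + h\<^sup>2)\<close>.\<close>
    define g where "g i = (if i = i0 then - (1 / k) else k) *\<^sub>R p i" for i
    have g_rest: "wip (I - {i0}) w g f = k * wip (I - {i0}) w p f" for w and f :: "'i \<Rightarrow> 'v"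
      unfolding wip_def sum_distrib_left by (intro sum.cong) (auto simp: g_def)
    have g_rest2: "wip (I - {i0}) w g g = k\<^sup>2 * wip (I - {i0}) w p p" for w
      using g_rest[of w g] g_rest[of w p] by (simp add: wip_commute[of _ _ p g] power2_eq_square)
    have ng: "wip I (\<lambda>_. 1) g g = 1"
    proof -
      have "wip I (\<lambda>_. 1) g g = C1\<^sup>2 / k\<^sup>2 + k\<^sup>2 * S2"
        by (simp add: wip_split g_rest2 flip: S2_def)
           (simp add: g_def C1_def dot_square_norm power_divide)
      also have "C1\<^sup>2 / k\<^sup>2 = S2" using k2 k0 by (simp add: field_simps)
      finally show ?thesis using k2 CS by simp
    qed
    have pg: "wip I (\<lambda>_. 1) p g = 0"
    proof -
      have "wip I (\<lambda>_. 1) g p = - (C1\<^sup>2 / k) + k * S2"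
        by (simp add: wip_split g_rest flip: S2_def) (simp add: g_def C1_def dot_square_norm)
      also have "C1\<^sup>2 / k = k * S2" using k2 k0 by (simp add: field_simps power2_eq_square)
      finally show ?thesis by (simp add: wip_commute)
    qed
    define b where "b i = \<beta> i *\<^sub>R y i" for i
    have wb: "wip I (\<lambda>_. 1) f b = wip I \<beta> f y" for f by (simp add: wip_def b_def)
    have bb: "wip I (\<lambda>_. 1) b b = \<mu>\<^sup>2 + R\<^sup>2"
      unfolding R2 by (simp add: wip_def b_def power2_eq_square algebra_simps)
    define Y where "Y = wip I \<beta> g y"
    \<comment> \<open>\<open>X\<close> takes up so much of \<open>b\<close> that Bessel leaves at
      most \<open>\<eta> * R\<close> for its component along \<open>g\<close>.\<close>
    have "X\<^sup>2 + Y\<^sup>2 \<le> \<mu>\<^sup>2 + R\<^sup>2" using wip_Bessel[OF np ng pg, of b] by (simp add: wb[of p] wb[of g] bb X_def Y_def)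
    hence "Y\<^sup>2 \<le> (\<eta> * R)\<^sup>2" using X2' by (simp add: algebra_simps power_mult_distrib)
    hence Y: "- (\<eta> * R) \<le> Y" using \<eta> R0 by (metis abs_le_square_iff abs_le_iff abs_of_nonneg mult_nonneg_nonneg minus_le_iff)
    define \<sigma> where "\<sigma> = sqrt (1 + h\<^sup>2)"
    have \<sigma>2: "\<sigma>\<^sup>2 = 1 + h\<^sup>2" and \<sigma>0: "0 < \<sigma>" by (simp_all add: \<sigma>_def add_pos_nonneg)
    \<comment> \<open>With \<open>\<sigma>\<^sup>2 = 1 + h\<^sup>2\<close> this identity exchanges
      \<open>\<mu> * \<sigma> + h * \<eta> * R\<close>, to be compared with \<open>X\<close>, for
      the quantity that \<open>rotation_bound\<close> keeps below \<open>R\<close>.\<close>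
    have "(\<mu> * \<sigma> + h * (\<eta> * R))\<^sup>2 = \<mu>\<^sup>2 + (\<mu> * h + \<eta> * R * \<sigma>)\<^sup>2 - \<eta>\<^sup>2 * R\<^sup>2"
    proof -
      have "(\<mu> * \<sigma> + h * (\<eta> * R))\<^sup>2 = \<mu>\<^sup>2 * \<sigma>\<^sup>2 + 2 * \<mu> * \<sigma> * h * \<eta> * R + h\<^sup>2 * \<eta>\<^sup>2 * R\<^sup>2"
        by (simp add: power2_eq_square algebra_simps)
      also have "\<dots> = \<mu>\<^sup>2 + (\<mu>\<^sup>2 * h\<^sup>2 + 2 * \<mu> * \<sigma> * h * \<eta> * R + \<eta>\<^sup>2 * R\<^sup>2 * \<sigma>\<^sup>2) - \<eta>\<^sup>2 * R\<^sup>2"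
        unfolding \<sigma>2 by (simp add: algebra_simps)
      finally show ?thesis by (simp add: power2_eq_square algebra_simps)
    qed
    also have "\<dots> < \<mu>\<^sup>2 + R\<^sup>2 - \<eta>\<^sup>2 * R\<^sup>2"
    proof -
      have "0 \<le> \<mu> * h + \<eta> * R * \<sigma>" using \<mu>0 rot(1) \<eta> R0 \<sigma>0 by simp
      hence "(\<mu> * h + \<eta> * R * \<sigma>)\<^sup>2 < R\<^sup>2" using rot(2) by (intro power_strict_mono) (auto simp: \<sigma>_def)
      thus ?thesis by simp
    qed
    also have "\<dots> \<le> X\<^sup>2" using X2' by (simp add: algebra_simps)
    finally have "\<mu> * \<sigma> + h * (\<eta> * R) < X"
      using X0 by (rule_tac power2_less_imp_less) (simp_all add: X_def)
    moreover have "h * (- (\<eta> * R)) \<le> h * Y" using Y rot(1) by (intro mult_left_mono)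
    ultimately have "\<mu> * \<sigma> < X + h * Y" by simp
    \<comment> \<open>The cone argument: Cauchy-Schwarz against \<open>y\<close> shows that the
      rotated vector still has quotient above \<open>\<mu>\<close>.\<close>
    hence "(\<mu> * \<sigma>)\<^sup>2 < (X + h * Y)\<^sup>2" using \<mu>0 \<sigma>0 by (intro power_strict_mono) auto
    also have "X + h * Y = wip I \<beta> (\<lambda>i. 1 *\<^sub>R p i + h *\<^sub>R g i) y"
      unfolding wip_lin_left by (simp add: X_def Y_def)
    also have "\<dots>\<^sup>2 \<le> wip I \<beta> (\<lambda>i. 1 *\<^sub>R p i + h *\<^sub>R g i) (\<lambda>i. 1 *\<^sub>R p i + h *\<^sub>R g i) * \<mu>"
      unfolding \<mu> by (rule wip_Cauchy_Schwarz) (rule \<beta>_nonneg)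
    finally have "\<mu> * (\<mu> * \<sigma>\<^sup>2) < \<mu> * wip I \<beta> (\<lambda>i. 1 *\<^sub>R p i + h *\<^sub>R g i) (\<lambda>i. 1 *\<^sub>R p i + h *\<^sub>R g i)"
      by (simp only: power_mult_distrib power2_eq_square ac_simps)
    hence "\<mu> * \<sigma>\<^sup>2 < wip I \<beta> (\<lambda>i. 1 *\<^sub>R p i + h *\<^sub>R g i) (\<lambda>i. 1 *\<^sub>R p i + h *\<^sub>R g i)"
      using \<mu>0 by (simp only: mult_less_cancel_left_pos)
    \<comment> \<open>The deficit of the quadratic form from \<open>\<mu>1\<close> times the squared
      norm comes only from the coordinates other than \<open>i0\<close>, which the rotation
      multiplies by \<open>1 + h * k\<close>.\<close>
    also have "\<dots> = \<mu>1 * \<sigma>\<^sup>2 - (1 + h * k)\<^sup>2 * (\<mu>1 - \<mu>')"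
    proof -
      define T where "T w = wip (I - {i0}) w p p" for w
      have gen: "wip I w (\<lambda>i. 1 *\<^sub>R p i + h *\<^sub>R g i) (\<lambda>i. 1 *\<^sub>R p i + h *\<^sub>R g i)
          = w i0 * ((1 - h / k)\<^sup>2 * C1\<^sup>2) + (1 + h * k)\<^sup>2 * T w" for w
      proof -
        have "inner (1 *\<^sub>R p i0 + h *\<^sub>R g i0) (1 *\<^sub>R p i0 + h *\<^sub>R g i0) = (1 - h / k)\<^sup>2 * C1\<^sup>2"
        proof -
          have "1 *\<^sub>R p i0 + h *\<^sub>R g i0 = (1 - h / k) *\<^sub>R p i0" by (simp add: g_def algebra_simps)
          thus ?thesis by (simp only: inner_scaleR_left inner_scaleR_right C1_def power2_norm_eq_inner)
             (simp add: power2_eq_square)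
        qed
        moreover have "wip (I - {i0}) w (\<lambda>i. 1 *\<^sub>R p i + h *\<^sub>R g i) (\<lambda>i. 1 *\<^sub>R p i + h *\<^sub>R g i)
            = (1 + h * k)\<^sup>2 * T w"
          unfolding wip_lin_self g_rest2 wip_commute[of _ _ p g] g_rest T_def
          by (simp add: power2_eq_square algebra_simps)
        ultimately show ?thesis using wip_split[of w "\<lambda>i. 1 *\<^sub>R p i + h *\<^sub>R g i"] by simp
      qed
      have "wip I (\<lambda>_. 1) (\<lambda>i. 1 *\<^sub>R p i + h *\<^sub>R g i) (\<lambda>i. 1 *\<^sub>R p i + h *\<^sub>R g i) = \<sigma>\<^sup>2"
        unfolding wip_lin_self np ng pg \<sigma>2 by simp
      hence "(1 - h / k)\<^sup>2 * C1\<^sup>2 + (1 + h * k)\<^sup>2 * S2 = \<sigma>\<^sup>2"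
        using gen[of "\<lambda>_. 1"] by (simp add: T_def S2_def)
      hence "(1 - h / k)\<^sup>2 * C1\<^sup>2 = \<sigma>\<^sup>2 - (1 + h * k)\<^sup>2 * S2" by linarith
      moreover have c: "C1\<^sup>2 = 1 - S2" using CS by linarith
      have "T \<beta> = \<mu>' - \<mu>1 * (1 - S2)" using split' unfolding c T_def by simp
      ultimately show ?thesis unfolding gen \<beta>_i0 by (simp only:) (simp add: algebra_simps)
    qed
    finally have up: "(1 + h * k)\<^sup>2 * (\<mu>1 - \<mu>') < (\<mu>1 - \<mu>) * \<sigma>\<^sup>2" by (simp add: algebra_simps)
    \<comment> \<open>The true tangent \<open>1 / k\<close> of \<open>p\<close> is at most
      \<open>\<tau>'\<close>: weights below \<open>\<mu>2\<close> force \<open>p\<close> closer to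
      \<open>i0\<close> to reach the quotient \<open>\<mu>'\<close>.\<close>
    have "1 \<le> (k * \<tau>')\<^sup>2"
    proof -
      have "S2 * (\<mu>' - \<mu>2) \<le> C1\<^sup>2 * (\<mu>1 - \<mu>')"
      proof -
        have c: "S2 = 1 - C1\<^sup>2" using CS by linarith
        show ?thesis using C1D unfolding c D_def by (simp add: algebra_simps)
      qed
      hence "S2 * (\<mu>' - \<mu>2) \<le> S2 * (k\<^sup>2 * (\<mu>1 - \<mu>'))" by (simp add: k2[symmetric] algebra_simps)
      hence "\<mu>' - \<mu>2 \<le> k\<^sup>2 * (\<mu>1 - \<mu>')" using S2 by simp
      thus ?thesis unfolding power_mult_distrib \<tau>'2 using gt le by (simp add: field_simps)
    qed
    \<comment> \<open>From here the upper bound \<open>up\<close> on the deficit is compared with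
      the plane case, where the addition formula \<open>\<tau> * (1 + \<tau>'\<^sup>2) = (\<tau>' +
      h) * (1 + \<tau> * \<tau>')\<close> gives quotient exactly \<open>\<mu>\<close>. The strict
      chain returns to its starting term.\<close>
    hence "1 \<le> k * \<tau>'" using power2_le_imp_le[of 1 "k * \<tau>'"] k0 \<tau>'pos by simp
    hence "h * 1 \<le> h * (k * \<tau>')" using rot(1) by (intro mult_left_mono)
    hence "\<tau>' + h \<le> \<tau>' * (1 + h * k)" by (simp add: algebra_simps)
    moreover have "0 \<le> \<tau>' + h" using \<tau>'pos rot(1) by simp
    ultimately have "(\<tau>' + h)\<^sup>2 \<le> (\<tau>' * (1 + h * k))\<^sup>2" by (rule power_mono)
    hence "(\<tau>' + h)\<^sup>2 * D \<le> (\<tau>' * (1 + h * k))\<^sup>2 * D" using D0 by (intro mult_right_mono) auto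
    also have "\<dots> = (1 + h * k)\<^sup>2 * (D * \<tau>'\<^sup>2)" by (simp only: power_mult_distrib ac_simps)
    also have "\<dots> = (1 + h * k)\<^sup>2 * (\<mu>1 - \<mu>') * (1 + \<tau>'\<^sup>2)" unfolding s(2)[symmetric] by (simp only: ac_simps)
    also have "\<dots> < (\<mu>1 - \<mu>) * \<sigma>\<^sup>2 * (1 + \<tau>'\<^sup>2)" using up pt by simp
    finally have "(\<tau>' + h)\<^sup>2 * D * (1 + \<tau>\<^sup>2) < (\<mu>1 - \<mu>) * \<sigma>\<^sup>2 * (1 + \<tau>'\<^sup>2) * (1 + \<tau>\<^sup>2)" using pt by simp
    also have "\<dots> = D * \<tau>\<^sup>2 * \<sigma>\<^sup>2 * (1 + \<tau>'\<^sup>2)" unfolding s(1)[symmetric] by (simp only: ac_simps)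
    finally have "D * ((\<tau>' + h)\<^sup>2 * (1 + \<tau>\<^sup>2)) < D * (\<tau>\<^sup>2 * \<sigma>\<^sup>2 * (1 + \<tau>'\<^sup>2))" by (simp only: ac_simps)
    hence "(\<tau>' + h)\<^sup>2 * (1 + \<tau>\<^sup>2) < \<tau>\<^sup>2 * \<sigma>\<^sup>2 * (1 + \<tau>'\<^sup>2)" using D0 by simp
    hence "(\<tau>' + h)\<^sup>2 * (1 + \<tau>\<^sup>2) * (1 + \<tau> * \<tau>')\<^sup>2
        < \<tau>\<^sup>2 * \<sigma>\<^sup>2 * (1 + \<tau>'\<^sup>2) * (1 + \<tau> * \<tau>')\<^sup>2"
      using p1 by (intro mult_strict_right_mono) auto
    also have "\<dots> = \<tau>\<^sup>2 * (1 + \<tau>'\<^sup>2) * (\<sigma>\<^sup>2 * (1 + \<tau> * \<tau>')\<^sup>2)" by (simp only: ac_simps)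
    also have "\<sigma>\<^sup>2 * (1 + \<tau> * \<tau>')\<^sup>2 = (1 + \<tau>\<^sup>2) * (1 + \<tau>'\<^sup>2)"
    proof -
      have "\<sigma>\<^sup>2 * (1 + \<tau> * \<tau>')\<^sup>2 = (1 + \<tau> * \<tau>')\<^sup>2 + (h * (1 + \<tau> * \<tau>'))\<^sup>2"
        unfolding \<sigma>2 power_mult_distrib by (simp only: distrib_right mult_1_left)
      thus ?thesis unfolding h by (simp add: power2_eq_square algebra_simps)
    qed
    also have "\<tau>\<^sup>2 * (1 + \<tau>'\<^sup>2) * ((1 + \<tau>\<^sup>2) * (1 + \<tau>'\<^sup>2)) = (\<tau> * (1 + \<tau>'\<^sup>2))\<^sup>2 * (1 + \<tau>\<^sup>2)"
      by (simp only: power2_eq_square ac_simps)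
    also have "\<tau> * (1 + \<tau>'\<^sup>2) = (\<tau>' + h) * (1 + \<tau> * \<tau>')"
      using h by (simp add: algebra_simps power2_eq_square)
    also have "((\<tau>' + h) * (1 + \<tau> * \<tau>'))\<^sup>2 * (1 + \<tau>\<^sup>2) = (\<tau>' + h)\<^sup>2 * (1 + \<tau>\<^sup>2) * (1 + \<tau> * \<tau>')\<^sup>2"
      by (simp only: power_mult_distrib ac_simps)
    finally show False by simp
  qed
qed

text \<open>The step length \<open>1 - \<eta>\<^sup>2\<close> turns the bound \<open>\<eta> \<parallel>a\<parallel>\<close> on \<open>r - a\<close> into the bound \<open>\<eta> \<parallel>r\<parallel>\<close> on
  \<open>p - \<beta> y\<close>.\<close>

lemma preconditioned_step:
  fixes y a :: "'i \<Rightarrow> 'v::real_inner"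
  assumes ny: "wip I (\<lambda>_. 1) y y = 1" and \<mu>: "\<mu> = wip I \<beta> y y"
    and gt: "\<mu>2 < \<mu>" and \<eta>: "0 \<le> \<eta>" "\<eta> < 1"
    and q: "q = \<eta> + (1 - \<eta>) * (\<mu>2 / \<mu>1)"
    and r: "r = (\<lambda>i. (\<beta> i - \<mu>) *\<^sub>R y i)"
    and res: "wip I (\<lambda>_. 1) (\<lambda>i. r i - a i) (\<lambda>i. r i - a i) \<le> \<eta>\<^sup>2 * wip I (\<lambda>_. 1) a a"
    and p: "p = (\<lambda>i. \<mu> *\<^sub>R y i + (1 - \<eta>\<^sup>2) *\<^sub>R a i)"
    and \<mu>': "\<mu>' = wip I \<beta> p p / wip I (\<lambda>_. 1) p p"
  shows "0 < wip I (\<lambda>_. 1) p p" "\<mu> \<le> \<mu>'"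
    "(\<mu>1 - \<mu>') * (\<mu> - \<mu>2) \<le> q\<^sup>2 * ((\<mu>1 - \<mu>) * (\<mu>' - \<mu>2))"
proof -
  define b where "b i = \<beta> i *\<^sub>R y i" for i
  define V where "V = wip I (\<lambda>i. (\<beta> i)\<^sup>2) y y - \<mu>\<^sup>2"
  define c where "c = 1 - \<eta>\<^sup>2"
  define N where "N = wip I (\<lambda>_. 1) p p"
  have \<mu>0: "0 < \<mu>" using gt \<mu>2_pos by simp
  have c0: "0 < c" using \<eta> by (simp add: c_def power_less_one_iff abs_square_less_1)
  have \<mu>le: "\<mu> \<le> \<mu>1" using wip_le_first[of y] ny by (simp add: \<mu>)
  have V0: "0 \<le> V"
  proof -
    have "0 \<le> (\<mu>1 - \<mu>) * (\<mu> - \<mu>2)" using \<mu>le gt by simp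
    thus ?thesis using variance_bound[OF ny] by (simp add: V_def \<mu>)
  qed
  have wb: "wip I (\<lambda>_. 1) f b = wip I \<beta> f y" for f by (simp add: wip_def b_def)
  have bb: "wip I (\<lambda>_. 1) b b = \<mu>\<^sup>2 + V"
    by (simp add: V_def wip_def b_def power2_eq_square algebra_simps)
  have r': "r = (\<lambda>i. 1 *\<^sub>R b i + (- \<mu>) *\<^sub>R y i)" by (simp add: r b_def algebra_simps)
  have rr: "wip I (\<lambda>_. 1) r r = V"
    unfolding r' wip_lin_self bb
    by (simp add: ny wip_commute[of I _ b] wb power2_eq_square flip: \<mu>)
  have res': "V - 2 * wip I (\<lambda>_. 1) r a + c * wip I (\<lambda>_. 1) a a \<le> 0"
  proof -
    have "(\<lambda>i. r i - a i) = (\<lambda>i. 1 *\<^sub>R r i + (-1) *\<^sub>R a i)" by simp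
    thus ?thesis using res unfolding wip_lin_self by (simp only: wip_lin_self rr) (simp add: c_def algebra_simps)
  qed
  \<comment> \<open>Both sides are the squared norm of \<open>p - b\<close>. Since
    \<open>b = \<mu> y + r\<close>, this difference is \<open>c a - r\<close>, and the choice
    \<open>c = 1 - \<eta>\<^sup>2\<close> makes the expanded residual bound a factor.\<close>
  have "N - 2 * wip I \<beta> p y + (\<mu>\<^sup>2 + V) = wip I (\<lambda>_. 1) (\<lambda>i. 1 *\<^sub>R p i + (-1) *\<^sub>R b i) (\<lambda>i. 1 *\<^sub>R p i + (-1) *\<^sub>R b i)"
    unfolding wip_lin_self bb N_def using wb[of p] by simp
  also have "(\<lambda>i. 1 *\<^sub>R p i + (-1) *\<^sub>R b i) = (\<lambda>i. c *\<^sub>R a i + (-1) *\<^sub>R r i)"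
    by (rule ext) (simp add: p r b_def c_def algebra_simps)
  also have "wip I (\<lambda>_. 1) (\<lambda>i. c *\<^sub>R a i + (-1) *\<^sub>R r i) (\<lambda>i. c *\<^sub>R a i + (-1) *\<^sub>R r i)
      = c * (V - 2 * wip I (\<lambda>_. 1) r a + c * wip I (\<lambda>_. 1) a a) + \<eta>\<^sup>2 * V"
    unfolding wip_lin_self rr by (simp add: wip_commute[of I _ a r] power2_eq_square c_def algebra_simps)
  also have "\<dots> \<le> \<eta>\<^sup>2 * V" using res' c0 by (simp add: mult_nonneg_nonpos)
  finally have key: "N + (\<mu>\<^sup>2 + c * V) \<le> 2 * wip I \<beta> p y" by (simp add: c_def algebra_simps)
  have N0: "0 \<le> N" unfolding N_def by (rule wip_nonneg) simp
  have Zp: "0 < \<mu>\<^sup>2 + c * V" using \<mu>0 c0 V0 by (simp add: add_pos_nonneg)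
  have pos: "0 < wip I \<beta> p y" using key N0 Zp by linarith
  have "(wip I (\<lambda>_. 1) p b)\<^sup>2 \<le> N * wip I (\<lambda>_. 1) b b" unfolding N_def by (rule wip_Cauchy_Schwarz) simp
  moreover have "0 < (wip I (\<lambda>_. 1) p b)\<^sup>2" using pos by (simp add: wb)
  ultimately have Npos: "0 < N" using N0 by (cases "N = 0") auto
  thus "0 < wip I (\<lambda>_. 1) p p" by (simp add: N_def)
  define u where "u = (\<lambda>i. (1 / sqrt N) *\<^sub>R p i)"
  have scale: "wip I w u f = wip I w p f / sqrt N" for w and f :: "'i \<Rightarrow> 'v"
    by (simp add: u_def wip_def sum_divide_distrib)
  have scale2: "wip I w u u = wip I w p p / N" for w
    using Npos scale[of w u] scale[of w p] by (simp add: wip_commute[of I w p u])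
  have nu: "wip I (\<lambda>_. 1) u u = 1" using Npos by (simp add: scale2 flip: N_def)
  have mu': "\<mu>' = wip I \<beta> u u" by (simp add: \<mu>' scale2 flip: N_def)
  have X0: "0 \<le> wip I \<beta> u y" using pos Npos by (simp add: scale)
  \<comment> \<open>The inequality of arithmetic and geometric means turns the sum in
    \<open>key\<close> into the product that remains after \<open>p\<close> is normalized.\<close>
  have "4 * (N * (\<mu>\<^sup>2 + c * V)) \<le> (N + (\<mu>\<^sup>2 + c * V))\<^sup>2"
    using zero_le_power2[of "N - (\<mu>\<^sup>2 + c * V)"] by (simp add: power2_eq_square algebra_simps)
  also have "\<dots> \<le> (2 * wip I \<beta> p y)\<^sup>2" using key N0 Zp by (intro power_mono) auto
  finally have "N * (\<mu>\<^sup>2 + c * V) \<le> (wip I \<beta> p y)\<^sup>2" by (simp add: power_mult_distrib)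
  hence "\<mu>\<^sup>2 + (1 - \<eta>\<^sup>2) * (wip I (\<lambda>i. (\<beta> i)\<^sup>2) y y - \<mu>\<^sup>2) \<le> (wip I \<beta> u y)\<^sup>2"
    using Npos by (simp add: scale power_divide field_simps flip: c_def V_def)
  note st = rotation_step[OF ny nu \<mu> mu' gt \<eta> q X0 this]
  show "\<mu> \<le> \<mu>'" "(\<mu>1 - \<mu>') * (\<mu> - \<mu>2) \<le> q\<^sup>2 * ((\<mu>1 - \<mu>) * (\<mu>' - \<mu>2))" by (fact st)+
qed

end

section \<open>Singular value decompositions and embeddings\<close>

abbreviation coords :: "complex vec \<Rightarrow> nat \<Rightarrow> complex" where
  "coords x \<equiv> (\<lambda>i. x $ i)"

lemma Re_cscalar_prod:
  assumes "x \<in> carrier_vec n" "z \<in> carrier_vec n"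
  shows "Re (x \<bullet>c z) = wip {..<n} (\<lambda>_. 1) (coords x) (coords z)"
  using assms by (auto simp: scalar_prod_def wip_def inner_complex_def lessThan_atLeast0 intro!: sum.cong)

lemma vnorm_sq: "x \<in> carrier_vec n \<Longrightarrow> (vnorm x)\<^sup>2 = Re (x \<bullet>c x)"
  by (subst Re_cscalar_prod)
     (auto simp: vnorm_def L2_set_def wip_def sum_nonneg power2_norm_eq_inner)

lemma vnorm_nonneg: "0 \<le> vnorm x"
  by (simp add: vnorm_def)

lemma mat_adjoint_carrier: "A \<in> carrier_mat m n \<Longrightarrow> mat_adjoint A \<in> carrier_mat n m"
  by (auto simp: mat_adjoint_def mat_of_rows_def)

lemma mat_adjoint_index:
  assumes "A \<in> carrier_mat m n" "i < n" "j < m"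
  shows "mat_adjoint A $$ (i, j) = conjugate (A $$ (j, i))"
  using assms by (auto simp: mat_adjoint_def mat_of_rows_def)

lemma cscalar_prod_adjoint:
  fixes A :: "complex mat"
  assumes A: "A \<in> carrier_mat m n" and x: "x \<in> carrier_vec n" and u: "u \<in> carrier_vec m"
  shows "(A *\<^sub>v x) \<bullet>c u = x \<bullet>c (mat_adjoint A *\<^sub>v u)"
proof -
  have "(A *\<^sub>v x) \<bullet>c u = (\<Sum>j<m. \<Sum>i<n. A $$ (j, i) * x $ i * cnj (u $ j))"
    using A x u by (auto simp: scalar_prod_def lessThan_atLeast0 sum_distrib_right intro!: sum.cong)
  also have "\<dots> = (\<Sum>i<n. \<Sum>j<m. A $$ (j, i) * x $ i * cnj (u $ j))"
    by (rule sum.swap)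
  also have "\<dots> = x \<bullet>c (mat_adjoint A *\<^sub>v u)"
    using A x u mat_adjoint_carrier[OF A]
    by (auto simp: scalar_prod_def lessThan_atLeast0 sum_distrib_left mat_adjoint_index[OF A] intro!: sum.cong)
  finally show ?thesis .
qed

lemma real_diag_carrier: "real_diag n s \<in> carrier_mat n n"
  by (simp add: real_diag_def)

lemma real_diag_mult_vec_index:
  assumes "x \<in> carrier_vec n" "i < n"
  shows "(real_diag n s *\<^sub>v x) $ i = complex_of_real (s (Suc i)) * x $ i"
  using assms
  by (auto simp: real_diag_def mat_diag_def scalar_prod_def if_distrib[of "\<lambda>x. x * _"] sum.delta cong: if_cong)

lemma adjoint_mult_cancel:
  fixes U :: "complex mat"
  assumes U: "U \<in> carrier_mat d n" "mat_adjoint U * U = 1\<^sub>m n" and g: "g \<in> carrier_vec n"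
  shows "mat_adjoint U *\<^sub>v (U *\<^sub>v g) = g"
  using assoc_mult_mat_vec[OF mat_adjoint_carrier[OF U(1)] U(1) g] U(2) g by simp

lemma unitary_cscalar_prod:
  fixes V :: "complex mat"
  assumes V: "V \<in> carrier_mat n n" "mat_adjoint V * V = 1\<^sub>m n"
    and x: "x \<in> carrier_vec n" and z: "z \<in> carrier_vec n"
  shows "(mat_adjoint V *\<^sub>v x) \<bullet>c (mat_adjoint V *\<^sub>v z) = x \<bullet>c z"
proof -
  have V': "mat_adjoint V \<in> carrier_mat n n" by (rule mat_adjoint_carrier[OF V(1)])
  have "V * mat_adjoint V = 1\<^sub>m n"
    by (rule mat_mult_left_right_inverse[OF V' V(1) V(2)])
  hence "x = V *\<^sub>v (mat_adjoint V *\<^sub>v x)" using V V' x by (simp flip: assoc_mult_mat_vec)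
  thus ?thesis using cscalar_prod_adjoint[of V n n "mat_adjoint V *\<^sub>v x" z] V V' x z by simp
qed

section \<open>Decompositions as quadratic forms; embedding and preconditioner\<close>

lemma economy_svd_carrier:
  assumes "economy_svd M U s V" "M \<in> carrier_mat d n"
  shows "V \<in> carrier_mat n n" "mat_adjoint V * V = 1\<^sub>m n"
  using assms by (auto simp: economy_svd_def Let_def)

lemma economy_svd_mono:
  assumes "economy_svd M U s V" "M \<in> carrier_mat d n" "1 \<le> i" "i \<le> j" "j \<le> n"
  shows "s j \<le> s i" "0 \<le> s j"
proof -
  have st: "\<forall>i\<in>{1..<n}. s (Suc i) \<le> s i" and nn: "\<forall>i\<in>{1..n}. 0 \<le> s i"
    using assms(1,2) by (auto simp: economy_svd_def Let_def)
  show "0 \<le> s j" using nn assms by auto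
  show "s j \<le> s i" using assms(4,5)
  proof (induction j rule: dec_induct)
    case (step j)
    have "s (Suc j) \<le> s j" using st step assms(3) by auto
    thus ?case using step by auto
  qed simp
qed

text \<open>The orthonormal columns of \<open>U\<close> drop out of the inner product, leaving the
  diagonal form of \<open>M\<^sup>*M\<close> in the basis of right singular vectors.\<close>

lemma economy_svd_Re_cscalar_prod:
  assumes svd: "economy_svd M U s V" and M: "M \<in> carrier_mat d n"
    and x: "x \<in> carrier_vec n" and z: "z \<in> carrier_vec n"
  shows "Re ((M *\<^sub>v x) \<bullet>c (M *\<^sub>v z))
    = wip {..<n} (\<lambda>i. (s (Suc i))\<^sup>2) (coords (mat_adjoint V *\<^sub>v x)) (coords (mat_adjoint V *\<^sub>v z))"
proof -
  have U: "U \<in> carrier_mat d n" "mat_adjoint U * U = 1\<^sub>m n"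
    and V: "V \<in> carrier_mat n n" and Meq: "M = U * real_diag n s * mat_adjoint V"
    using svd M by (auto simp: economy_svd_def Let_def)
  have V': "mat_adjoint V \<in> carrier_mat n n" by (rule mat_adjoint_carrier[OF V])
  have U': "mat_adjoint U \<in> carrier_mat n d" by (rule mat_adjoint_carrier[OF U(1)])
  define D where "D = real_diag n s"
  have D: "D \<in> carrier_mat n n" by (simp add: D_def real_diag_carrier)
  have Mv: "M *\<^sub>v t = U *\<^sub>v (D *\<^sub>v (mat_adjoint V *\<^sub>v t))" if "t \<in> carrier_vec n" for t
    unfolding Meq D_def[symmetric] using U V' D that by (simp add: assoc_mult_mat_vec[of _ d n _ n])
  define f g where "f = mat_adjoint V *\<^sub>v x" and "g = mat_adjoint V *\<^sub>v z"
  have fg: "f \<in> carrier_vec n" "g \<in> carrier_vec n" using V' x z by (auto simp: f_def g_def)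
  have Dfg: "D *\<^sub>v f \<in> carrier_vec n" "D *\<^sub>v g \<in> carrier_vec n" using D fg by auto
  have "(M *\<^sub>v x) \<bullet>c (M *\<^sub>v z) = (D *\<^sub>v f) \<bullet>c (mat_adjoint U *\<^sub>v (U *\<^sub>v (D *\<^sub>v g)))"
    unfolding Mv[OF x] Mv[OF z] f_def[symmetric] g_def[symmetric]
    by (rule cscalar_prod_adjoint[OF U(1) Dfg(1)]) (use U Dfg in auto)
  also have "mat_adjoint U *\<^sub>v (U *\<^sub>v (D *\<^sub>v g)) = D *\<^sub>v g"
    by (rule adjoint_mult_cancel[OF U Dfg(2)])
  finally have "Re ((M *\<^sub>v x) \<bullet>c (M *\<^sub>v z)) = wip {..<n} (\<lambda>_. 1) (coords (D *\<^sub>v f)) (coords (D *\<^sub>v g))"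
    by (simp add: Re_cscalar_prod[OF Dfg])
  also have "\<dots> = wip {..<n} (\<lambda>i. (s (Suc i))\<^sup>2) (coords f) (coords g)"
    unfolding wip_def
    by (rule sum.cong) (auto simp: D_def real_diag_mult_vec_index fg inner_complex_def power2_eq_square algebra_simps)
  finally show ?thesis by (simp add: f_def g_def)
qed

text \<open>The embedding says that the quadratic form of \<open>(S A)\<^sup>*(S A) - A\<^sup>*A\<close> is at most \<open>\<eta>\<close> times that
  of \<open>A\<^sup>*A\<close> in absolute value; polarization gives the same bound for the operator norm.\<close>

lemma embedding_dual_bound:
  fixes A S VA :: "complex mat"
  assumes A: "A \<in> carrier_mat m n" and S: "S \<in> carrier_mat d m"
    and svd: "economy_svd A UA \<sigma> VA" and pos: "\<And>i. i < n \<Longrightarrow> 0 < \<sigma> (Suc i)"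
    and emb: "subspace_embedding S A \<eta>" and \<eta>: "0 \<le> \<eta>"
    and c_def: "\<And>z i. c z i = complex_of_real (\<sigma> (Suc i)) * (mat_adjoint VA *\<^sub>v z) $ i"
    and a: "a \<in> carrier_vec n"
    and dual: "\<And>z. z \<in> carrier_vec n \<Longrightarrow>
      Re (((S * A) *\<^sub>v a) \<bullet>c ((S * A) *\<^sub>v z)) = wip {..<n} (\<lambda>_. 1) f (c z)"
  shows "wip {..<n} (\<lambda>_. 1) (\<lambda>i. f i - c a i) (\<lambda>i. f i - c a i)
    \<le> \<eta>\<^sup>2 * wip {..<n} (\<lambda>_. 1) (c a) (c a)"
proof -
  note V = economy_svd_carrier[OF svd A]
  have V': "mat_adjoint VA \<in> carrier_mat n n" by (rule mat_adjoint_carrier[OF V(1)])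
  have SA: "S * A \<in> carrier_mat d n" using S A by simp
  \<comment> \<open>The test vector is the error itself: its scaled coordinates \<open>c z\<close>
    equal \<open>f - c a\<close>. Dividing by the positive singular values makes this
    possible.\<close>
  define z where "z = VA *\<^sub>v vec n (\<lambda>i. (f i - c a i) / complex_of_real (\<sigma> (Suc i)))"
  have z: "z \<in> carrier_vec n" using V by (simp add: z_def)
  have "mat_adjoint VA *\<^sub>v z = vec n (\<lambda>i. (f i - c a i) / complex_of_real (\<sigma> (Suc i)))"
    unfolding z_def by (rule adjoint_mult_cancel[OF V]) simp
  hence cz: "c z i = f i - c a i" if "i < n" for i
    using that pos[OF that] by (simp add: c_def)
  have Ac: "Re ((A *\<^sub>v x) \<bullet>c (A *\<^sub>v y)) = wip {..<n} (\<lambda>_. 1) (c x) (c y)"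
    if "x \<in> carrier_vec n" "y \<in> carrier_vec n" for x y
    unfolding economy_svd_Re_cscalar_prod[OF svd A that] wip_def c_def
    by (simp add: inner_complex_def power2_eq_square algebra_simps)
  have Ssq: "(vnorm ((S * A) *\<^sub>v x))\<^sup>2 = Re (((S * A) *\<^sub>v x) \<bullet>c ((S * A) *\<^sub>v x))"
    and Asq: "(vnorm (A *\<^sub>v x))\<^sup>2 = Re ((A *\<^sub>v x) \<bullet>c (A *\<^sub>v x))" if "x \<in> carrier_vec n" for x
    by (rule vnorm_sq[of _ d], use SA that in simp) (rule vnorm_sq[of _ m], use A that in simp)
  define N Z where "N = wip {..<n} (\<lambda>_. 1) (c a) (c a)" and "Z = wip {..<n} (\<lambda>_. 1) (c z) (c z)"
  define \<gamma> where "\<gamma> = wip {..<n} (\<lambda>_. 1) (c a) (c z)"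
  define Sz where "Sz = Re (((S * A) *\<^sub>v z) \<bullet>c ((S * A) *\<^sub>v z))"
  define Sa where "Sa = Re (((S * A) *\<^sub>v a) \<bullet>c ((S * A) *\<^sub>v a))"
  define Saz where "Saz = Re (((S * A) *\<^sub>v a) \<bullet>c ((S * A) *\<^sub>v z))"
  have Z0: "0 \<le> Z" and N0: "0 \<le> N" unfolding Z_def N_def by (auto intro!: wip_nonneg)
  have expand: "Re ((M *\<^sub>v (a + complex_of_real t \<cdot>\<^sub>v z)) \<bullet>c (M *\<^sub>v (a + complex_of_real t \<cdot>\<^sub>v z)))
     = Re ((M *\<^sub>v a) \<bullet>c (M *\<^sub>v a)) + 2 * t * Re ((M *\<^sub>v a) \<bullet>c (M *\<^sub>v z)) + t\<^sup>2 * Re ((M *\<^sub>v z) \<bullet>c (M *\<^sub>v z))"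
    if M: "M \<in> carrier_mat l n" for M l t
  proof -
    have Mv: "M *\<^sub>v a \<in> carrier_vec l" "M *\<^sub>v z \<in> carrier_vec l" using M a z by auto
    have "M *\<^sub>v (a + complex_of_real t \<cdot>\<^sub>v z) = M *\<^sub>v a + complex_of_real t \<cdot>\<^sub>v (M *\<^sub>v z)"
      using M a z by (simp add: mult_add_distrib_mat_vec[of _ l n] mult_mat_vec[of _ l n])
    moreover have "wip {..<l} (\<lambda>_. 1) (coords (M *\<^sub>v a + complex_of_real t \<cdot>\<^sub>v (M *\<^sub>v z)))
        (coords (M *\<^sub>v a + complex_of_real t \<cdot>\<^sub>v (M *\<^sub>v z)))
      = wip {..<l} (\<lambda>_. 1) (\<lambda>i. 1 *\<^sub>R (M *\<^sub>v a) $ i + t *\<^sub>R (M *\<^sub>v z) $ i)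
          (\<lambda>i. 1 *\<^sub>R (M *\<^sub>v a) $ i + t *\<^sub>R (M *\<^sub>v z) $ i)"
    proof -
      have idx: "(f + complex_of_real t \<cdot>\<^sub>v g) $ i = 1 *\<^sub>R f $ i + t *\<^sub>R g $ i"
        if "f \<in> carrier_vec l" "g \<in> carrier_vec l" "i < l" for f g i
        using that by (simp add: scaleR_conv_of_real)
      show ?thesis unfolding wip_def by (intro sum.cong) (simp_all only: lessThan_iff idx[OF Mv])
    qed
    ultimately show ?thesis
      using Mv by (simp only: Re_cscalar_prod[of _ l] add_carrier_vec smult_carrier_vec wip_lin_self)
        simp
  qed
  have diff: "Saz - \<gamma> = Z"
  proof -
    have "Saz = wip {..<n} (\<lambda>_. 1) f (c z)" unfolding Saz_def by (rule dual[OF z])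
    also have "\<dots> - \<gamma> = wip {..<n} (\<lambda>_. 1) (\<lambda>i. 1 *\<^sub>R f i + (-1) *\<^sub>R c a i) (c z)"
      unfolding wip_lin_left by (simp add: \<gamma>_def)
    also have "\<dots> = Z" unfolding Z_def wip_def by (rule sum.cong) (auto simp: cz)
    finally show ?thesis .
  qed
  have upper: "Sa + 2 * t * Saz + t\<^sup>2 * Sz \<le> (1 + \<eta>) * (N + 2 * t * \<gamma> + t\<^sup>2 * Z)"
    and lower: "(1 - \<eta>) * (N + 2 * t * \<gamma> + t\<^sup>2 * Z) \<le> Sa + 2 * t * Saz + t\<^sup>2 * Sz" for t
  proof -
    let ?x = "a + complex_of_real t \<cdot>\<^sub>v z"
    have x: "?x \<in> carrier_vec n" using a z by simp
    have s: "(vnorm ((S * A) *\<^sub>v ?x))\<^sup>2 = Sa + 2 * t * Saz + t\<^sup>2 * Sz"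
      unfolding Ssq[OF x] expand[OF SA] Sa_def Saz_def Sz_def ..
    have a': "(vnorm (A *\<^sub>v ?x))\<^sup>2 = N + 2 * t * \<gamma> + t\<^sup>2 * Z"
      unfolding Asq[OF x] expand[OF A] Ac[OF a a] Ac[OF a z] Ac[OF z z] N_def \<gamma>_def Z_def ..
    show "Sa + 2 * t * Saz + t\<^sup>2 * Sz \<le> (1 + \<eta>) * (N + 2 * t * \<gamma> + t\<^sup>2 * Z)"
      "(1 - \<eta>) * (N + 2 * t * \<gamma> + t\<^sup>2 * Z) \<le> Sa + 2 * t * Saz + t\<^sup>2 * Sz"
      using emb x A unfolding subspace_embedding_def s[symmetric] a'[symmetric] by auto
  qed
  \<comment> \<open>Subtract the lower embedding bound at \<open>a - t z\<close> from the upper one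
    at \<open>a + t z\<close>: \<open>Sa\<close> and \<open>Sz\<close> cancel, and the cross terms
    leave \<open>Saz - \<gamma> = Z\<close>.\<close>
  have polar: "2 * t * Z \<le> \<eta> * (N + t\<^sup>2 * Z)" for t
  proof -
    have "(Sa + 2 * t * Saz + t\<^sup>2 * Sz) - (Sa + 2 * (- t) * Saz + (- t)\<^sup>2 * Sz)
      \<le> (1 + \<eta>) * (N + 2 * t * \<gamma> + t\<^sup>2 * Z) - (1 - \<eta>) * (N + 2 * (- t) * \<gamma> + (- t)\<^sup>2 * Z)"
      using upper[of t] lower[of "- t"] by linarith
    hence "2 * t * (Saz - \<gamma>) \<le> \<eta> * (N + t\<^sup>2 * Z)" by (simp add: algebra_simps)
    thus ?thesis by (simp add: diff)
  qed
  \<comment> \<open>The choice \<open>t = 1 / \<eta>\<close> gives the claim; for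
    \<open>\<eta> = 0\<close> already \<open>t = 1\<close> forces \<open>Z = 0\<close>.\<close>
  have "Z \<le> \<eta>\<^sup>2 * N"
  proof (cases "\<eta> = 0")
    case True thus ?thesis using polar[of 1] Z0 by simp
  next
    case False
    hence "\<eta> > 0" using \<eta> by simp
    thus ?thesis using polar[of "1 / \<eta>"] by (simp add: field_simps power2_eq_square)
  qed
  moreover have "Z = wip {..<n} (\<lambda>_. 1) (\<lambda>i. f i - c a i) (\<lambda>i. f i - c a i)"
    unfolding Z_def wip_def by (rule sum.cong) (auto simp: cz)
  ultimately show ?thesis by (simp add: N_def)
qed

text \<open>\<open>P P\<^sup>*\<close> is \<open>V \<Sigma>\<^sup>-\<^sup>2 V\<^sup>*\<close>, the
  inverse of \<open>M\<^sup>*M\<close>. The weak form tested against \<open>z\<close> is the shape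
  in which the embedding bound consumes it.\<close>

lemma preconditioner_inverse:
  assumes svd: "economy_svd M U s V" and M: "M \<in> carrier_mat d n"
    and pos: "\<And>i. i < n \<Longrightarrow> 0 < s (Suc i)"
    and P: "P = V * real_diag n (\<lambda>i. 1 / s i)"
    and u: "u \<in> carrier_vec n" and z: "z \<in> carrier_vec n"
  shows "P *\<^sub>v (mat_adjoint P *\<^sub>v u) \<in> carrier_vec n"
    "Re ((M *\<^sub>v (P *\<^sub>v (mat_adjoint P *\<^sub>v u))) \<bullet>c (M *\<^sub>v z)) = Re (u \<bullet>c z)"
proof -
  note V = economy_svd_carrier[OF svd M]
  have V': "mat_adjoint V \<in> carrier_mat n n" by (rule mat_adjoint_carrier[OF V(1)])
  define D where "D = real_diag n (\<lambda>i. 1 / s i)"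
  have D: "D \<in> carrier_mat n n" by (simp add: D_def real_diag_carrier)
  have Pc: "P \<in> carrier_mat n n" using V D by (simp add: P D_def[symmetric])
  have P': "mat_adjoint P \<in> carrier_mat n n" by (rule mat_adjoint_carrier[OF Pc])
  show Pu: "P *\<^sub>v (mat_adjoint P *\<^sub>v u) \<in> carrier_vec n" using Pc P' u by simp
  \<comment> \<open>The diagonal factor is real, hence self-adjoint, and contributes one factor
    \<open>1 / s\<close> here and a second one when \<open>P\<close> is applied.\<close>
  have Pu': "(mat_adjoint P *\<^sub>v u) $ i = complex_of_real (1 / s (Suc i)) * (mat_adjoint V *\<^sub>v u) $ i"
    if i: "i < n" for i
  proof -
    have "mat_adjoint P $$ (i, j) = complex_of_real (1 / s (Suc i)) * mat_adjoint V $$ (i, j)"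
      if j: "j < n" for j
      unfolding mat_adjoint_index[OF Pc i j] mat_adjoint_index[OF V(1) i j]
      unfolding P real_diag_def mat_diag_mult_right[OF V(1)] using i j by simp
    thus ?thesis using P' V' u i
      by (auto simp: scalar_prod_def sum_distrib_left mult.assoc intro!: sum.cong)
  qed
  have "P *\<^sub>v (mat_adjoint P *\<^sub>v u) = V *\<^sub>v (D *\<^sub>v (mat_adjoint P *\<^sub>v u))"
    unfolding P D_def[symmetric]
    by (rule assoc_mult_mat_vec[OF V(1) D]) (use P' u in \<open>simp add: P D_def\<close>)
  moreover have "mat_adjoint V *\<^sub>v (V *\<^sub>v (D *\<^sub>v (mat_adjoint P *\<^sub>v u))) = D *\<^sub>v (mat_adjoint P *\<^sub>v u)"
    by (rule adjoint_mult_cancel[OF V]) (use D P' u in simp)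
  ultimately have eq: "mat_adjoint V *\<^sub>v (P *\<^sub>v (mat_adjoint P *\<^sub>v u)) = D *\<^sub>v (mat_adjoint P *\<^sub>v u)" by simp
  hence idx: "(mat_adjoint V *\<^sub>v (P *\<^sub>v (mat_adjoint P *\<^sub>v u))) $ i
      = (1 / (s (Suc i))\<^sup>2) *\<^sub>R (mat_adjoint V *\<^sub>v u) $ i" if "i < n" for i
    unfolding eq D_def real_diag_mult_vec_index[OF mult_mat_vec_carrier[OF P' u] that] Pu'[OF that]
    by (simp add: scaleR_conv_of_real power2_eq_square)
  have "Re ((M *\<^sub>v (P *\<^sub>v (mat_adjoint P *\<^sub>v u))) \<bullet>c (M *\<^sub>v z))
    = wip {..<n} (\<lambda>_. 1) (coords (mat_adjoint V *\<^sub>v u)) (coords (mat_adjoint V *\<^sub>v z))"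
    unfolding economy_svd_Re_cscalar_prod[OF svd M Pu z] wip_def
  proof (rule sum.cong)
    fix i assume "i \<in> {..<n}"
    thus "(s (Suc i))\<^sup>2 * inner ((mat_adjoint V *\<^sub>v (P *\<^sub>v (mat_adjoint P *\<^sub>v u))) $ i) ((mat_adjoint V *\<^sub>v z) $ i)
      = 1 * inner ((mat_adjoint V *\<^sub>v u) $ i) ((mat_adjoint V *\<^sub>v z) $ i)"
      using pos[of i] by (simp add: idx)
  qed simp
  also have "\<dots> = Re (u \<bullet>c z)"
    using V' u z by (simp add: unitary_cscalar_prod[OF V u z] flip: Re_cscalar_prod)
  finally show "Re ((M *\<^sub>v (P *\<^sub>v (mat_adjoint P *\<^sub>v u))) \<bullet>c (M *\<^sub>v z)) = Re (u \<bullet>c z)" .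
qed

section \<open>Scaling, spans, extremal norms and angles\<close>

lemma vnorm_smult:
  "vnorm (complex_of_real a \<cdot>\<^sub>v x) = \<bar>a\<bar> * vnorm x"
proof -
  have "vnorm (complex_of_real a \<cdot>\<^sub>v x) = L2_set (\<lambda>i. \<bar>a\<bar> * cmod (x $ i)) {..<dim_vec x}"
    unfolding vnorm_def by (rule L2_set_cong) (auto simp: norm_mult)
  thus ?thesis by (simp add: L2_set_right_distrib vnorm_def)
qed

lemma cspan_carrier:
  assumes "X \<subseteq> carrier_vec n" "z \<in> cspan n X"
  shows "z \<in> carrier_vec n"
proof -
  interpret vec_space "TYPE(complex)" n .
  show ?thesis using span_closed[of X z] assms by (simp add: cspan_def)
qed

lemma cspan_lincomb:
  assumes X: "X \<subseteq> carrier_vec n" and x: "x \<in> X" and y: "y \<in> X"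
  shows "a \<cdot>\<^sub>v x + b \<cdot>\<^sub>v y \<in> cspan n X"
proof -
  interpret vec_space "TYPE(complex)" n .
  have "x \<in> span X" "y \<in> span X" using in_own_span[of X] X x y by auto
  thus ?thesis unfolding cspan_def by (intro span_add1[OF X] smult_in_span[OF X])
qed

lemma economy_svd_vnorm:
  assumes svd: "economy_svd M U s V" and M: "M \<in> carrier_mat d n" and z: "z \<in> carrier_vec n"
  shows "(vnorm z)\<^sup>2 = (\<Sum>i<n. (cmod ((mat_adjoint V *\<^sub>v z) $ i))\<^sup>2)"
    "(vnorm (M *\<^sub>v z))\<^sup>2 = (\<Sum>i<n. (s (Suc i))\<^sup>2 * (cmod ((mat_adjoint V *\<^sub>v z) $ i))\<^sup>2)"
proof -
  note V = economy_svd_carrier[OF svd M]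
  have Vz: "mat_adjoint V *\<^sub>v z \<in> carrier_vec n" using mat_adjoint_carrier[OF V(1)] z by simp
  have "(vnorm z)\<^sup>2 = Re ((mat_adjoint V *\<^sub>v z) \<bullet>c (mat_adjoint V *\<^sub>v z))"
    by (simp only: vnorm_sq[OF z] unitary_cscalar_prod[OF V z z])
  thus "(vnorm z)\<^sup>2 = (\<Sum>i<n. (cmod ((mat_adjoint V *\<^sub>v z) $ i))\<^sup>2)"
    by (simp only: Re_cscalar_prod[OF Vz Vz] wip_self mult_1_left)
  have Mz: "M *\<^sub>v z \<in> carrier_vec d" using M z by simp
  show "(vnorm (M *\<^sub>v z))\<^sup>2 = (\<Sum>i<n. (s (Suc i))\<^sup>2 * (cmod ((mat_adjoint V *\<^sub>v z) $ i))\<^sup>2)"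
    by (simp only: vnorm_sq[OF Mz] economy_svd_Re_cscalar_prod[OF svd M z z] wip_self)
qed

lemma economy_svd_vnorm_ge:
  assumes svd: "economy_svd M U s V" and M: "M \<in> carrier_mat d n" and z: "z \<in> carrier_vec n"
  shows "(s n)\<^sup>2 * (vnorm z)\<^sup>2 \<le> (vnorm (M *\<^sub>v z))\<^sup>2"
  unfolding economy_svd_vnorm[OF svd M z] sum_distrib_left
proof (rule sum_mono)
  fix i assume "i \<in> {..<n}"
  hence "s n \<le> s (Suc i)" "0 \<le> s n" using economy_svd_mono[OF svd M, of "Suc i" n] by auto
  thus "(s n)\<^sup>2 * (cmod ((mat_adjoint V *\<^sub>v z) $ i))\<^sup>2 \<le> (s (Suc i))\<^sup>2 * (cmod ((mat_adjoint V *\<^sub>v z) $ i))\<^sup>2"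
    by (intro mult_right_mono power_mono) auto
qed

text \<open>With \<open>c\<close> the cosine, the last hypothesis gives
  \<open>(l2 - l1) * (1 - c\<^sup>2) \<le> \<rho> - l1\<close> and
  \<open>l2 - \<rho> \<le> (l2 - l1) * c\<^sup>2\<close>, so the squared tangent is at most
  \<open>(\<rho> - l1) / (l2 - \<rho>)\<close>.\<close>

lemma angle_bounds:
  fixes c K l1 l2 \<rho> :: real
  assumes "0 \<le> c" "c \<le> 1" "l1 < l2" "\<rho> < l2" and K: "\<rho> - l1 \<le> K * (l2 - \<rho>)" "0 \<le> K"
    and \<rho>: "l1 * c\<^sup>2 + l2 * (1 - c\<^sup>2) \<le> \<rho>"
  shows "\<bar>sin (arccos c)\<bar> \<le> \<bar>tan (arccos c)\<bar>" "\<bar>tan (arccos c)\<bar> \<le> sqrt K"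
proof -
  \<comment> \<open>Positivity of \<open>c\<close> excludes the right angle, where
    \<open>tan\<close> is 0 and the comparison with the sine would fail.\<close>
  have "0 < (l2 - l1) * c\<^sup>2" using assms(4) \<rho> by (simp add: algebra_simps)
  hence c: "0 < c" using assms(1,3) by (simp add: zero_less_mult_iff less_le)
  have t: "tan (arccos c) = sqrt (1 - c\<^sup>2) / c"
    using assms(1,2) by (simp add: tan_def sin_arccos cos_arccos)
  have c1: "c\<^sup>2 \<le> 1" using assms(1,2) by (simp add: power_le_one)
  have "sqrt (1 - c\<^sup>2) * c \<le> sqrt (1 - c\<^sup>2)" using assms(1,2) c1 by (simp add: mult_left_le)
  thus "\<bar>sin (arccos c)\<bar> \<le> \<bar>tan (arccos c)\<bar>"
    unfolding t using assms(1,2) c c1 by (simp add: sin_arccos field_simps)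
  have "K * (l2 - \<rho>) \<le> K * ((l2 - l1) * c\<^sup>2)"
    using \<rho> K(2) by (intro mult_left_mono) (auto simp: algebra_simps)
  hence "(l2 - l1) * (1 - c\<^sup>2) \<le> (l2 - l1) * (K * c\<^sup>2)"
    using K(1) \<rho> by (simp add: algebra_simps)
  hence "(1 - c\<^sup>2) \<le> K * c\<^sup>2" using assms(3) by simp
  hence "(1 - c\<^sup>2) / c\<^sup>2 \<le> K" using c by (simp add: pos_divide_le_eq)
  hence "sqrt ((1 - c\<^sup>2) / c\<^sup>2) \<le> sqrt K" by simp
  thus "\<bar>tan (arccos c)\<bar> \<le> sqrt K" unfolding t using c c1 by (simp add: real_sqrt_divide)
qed

section \<open>The algorithm: \<open>VA\<close> supplies the coordinates for the analysis,
  \<open>V\<close> the preconditioner\<close>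

locale embedded_svd =
  fixes A S UA VA U V P :: "complex mat" and m n d :: nat and \<sigma> s :: "nat \<Rightarrow> real" and \<eta> :: real
  assumes A: "A \<in> carrier_mat m n" and S: "S \<in> carrier_mat d m" and n2: "2 \<le> n"
    and svd: "economy_svd A UA \<sigma> VA" and \<sigma>n: "0 < \<sigma> n"
    and \<eta>: "0 \<le> \<eta>" "\<eta> < 1" and emb: "subspace_embedding S A \<eta>"
    and svdS: "economy_svd (S * A) U s V" and P: "P = V * real_diag n (\<lambda>i. 1 / s i)"
begin

lemma SA: "S * A \<in> carrier_mat d n"
  using S A by simp

lemma \<sigma>_ge: "i < n \<Longrightarrow> \<sigma> n \<le> \<sigma> (Suc i)"
  using economy_svd_mono[OF svd A, of "Suc i" n] by simp

lemma \<sigma>_pos: "i < n \<Longrightarrow> 0 < \<sigma> (Suc i)"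
  using \<sigma>_ge \<sigma>n by fastforce

lemma \<sigma>_ge': "i < n - 1 \<Longrightarrow> \<sigma> (n - 1) \<le> \<sigma> (Suc i)"
  using economy_svd_mono[OF svd A, of "Suc i" "n - 1"] by simp

lemma embedding:
  assumes "z \<in> carrier_vec n"
  shows "(1 - \<eta>) * (vnorm (A *\<^sub>v z))\<^sup>2 \<le> (vnorm ((S * A) *\<^sub>v z))\<^sup>2"
    "(vnorm ((S * A) *\<^sub>v z))\<^sup>2 \<le> (1 + \<eta>) * (vnorm (A *\<^sub>v z))\<^sup>2"
  using emb assms A by (auto simp: subspace_embedding_def)

lemma last_right_vector:
  assumes z: "z \<in> carrier_vec n"
    and zero: "\<And>i. i < n - 1 \<Longrightarrow> (mat_adjoint V *\<^sub>v z) $ i = 0"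
  shows "(vnorm ((S * A) *\<^sub>v z))\<^sup>2 = (s n)\<^sup>2 * (vnorm z)\<^sup>2"
  unfolding economy_svd_vnorm[OF svdS SA z] sum_distrib_left
proof (rule sum.cong)
  fix i assume "i \<in> {..<n}"
  thus "(s (Suc i))\<^sup>2 * (cmod ((mat_adjoint V *\<^sub>v z) $ i))\<^sup>2 = (s n)\<^sup>2 * (cmod ((mat_adjoint V *\<^sub>v z) $ i))\<^sup>2"
  proof (cases "i < n - 1")
    case False
    hence "Suc i = n" using \<open>i \<in> {..<n}\<close> by auto
    thus ?thesis by simp
  qed (simp add: zero)
qed simp

lemma V: "V \<in> carrier_mat n n" "mat_adjoint V * V = 1\<^sub>m n"
  using economy_svd_carrier[OF svdS SA] by auto

text \<open>On the last right singular vector of \<open>S * A\<close> the squared norm is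
  \<open>(s n)\<^sup>2\<close>, while the embedding keeps it at least
  \<open>(1 - \<eta>) * (\<sigma> n)\<^sup>2 > 0\<close>. Hence \<open>1 / s i\<close> in
  \<open>P\<close> is a genuine inverse.\<close>

lemma s_pos:
  assumes "i < n" shows "0 < s (Suc i)"
proof -
  define z where "z = V *\<^sub>v unit_vec n (n - 1)"
  have z: "z \<in> carrier_vec n" using V by (simp add: z_def)
  have Vz: "mat_adjoint V *\<^sub>v z = unit_vec n (n - 1)"
    unfolding z_def by (rule adjoint_mult_cancel[OF V]) simp
  have "(vnorm z)\<^sup>2 = (\<Sum>i<n. if i = n - 1 then 1 else 0)"
    unfolding economy_svd_vnorm[OF svdS SA z] Vz using n2 by (intro sum.cong) auto
  also have "\<dots> = 1" using n2 by (simp add: sum.delta)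
  finally have z1: "(vnorm z)\<^sup>2 = 1" .
  have "(vnorm ((S * A) *\<^sub>v z))\<^sup>2 = (s n)\<^sup>2"
    using last_right_vector[OF z] n2 by (simp add: Vz z1)
  moreover have "0 < (1 - \<eta>) * (\<sigma> n)\<^sup>2" using \<eta> \<sigma>n by simp
  moreover have "(1 - \<eta>) * (\<sigma> n)\<^sup>2 \<le> (1 - \<eta>) * (vnorm (A *\<^sub>v z))\<^sup>2"
    using economy_svd_vnorm_ge[OF svd A z] \<eta> by (intro mult_left_mono) (auto simp: z1)
  ultimately have "0 < (s n)\<^sup>2" using embedding(1)[OF z] by linarith
  moreover have "0 \<le> s n" "s n \<le> s (Suc i)" using economy_svd_mono[OF svdS SA, of "Suc i" n] assms by auto
  ultimately show ?thesis by (cases "s n = 0") auto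
qed

text \<open>\<open>P\<close> only rescales the columns of \<open>V\<close>, so the normalized start
  is the last right singular vector of \<open>S * A\<close>.\<close>

lemma initial_vector:
  assumes p: "p = P *\<^sub>v unit_vec n (n - 1)"
    and x: "x = complex_of_real (1 / vnorm p) \<cdot>\<^sub>v p"
  shows "x \<in> carrier_vec n" "vnorm x = 1" "(vnorm ((S * A) *\<^sub>v x))\<^sup>2 = (s n)\<^sup>2"
proof -
  define e where "e = real_diag n (\<lambda>i. 1 / s i) *\<^sub>v unit_vec n (n - 1)"
  have e: "e \<in> carrier_vec n" using real_diag_carrier[of n "\<lambda>i. 1 / s i"] by (simp add: e_def)
  have pe: "p = V *\<^sub>v e"
    unfolding p P e_def by (rule assoc_mult_mat_vec[OF V(1) real_diag_carrier]) simp
  have pc: "p \<in> carrier_vec n" using V e by (simp add: pe)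
  show xc: "x \<in> carrier_vec n" using pc by (simp add: x)
  have Vp: "mat_adjoint V *\<^sub>v p = e" unfolding pe by (rule adjoint_mult_cancel[OF V e])
  have ei: "e $ i = complex_of_real (1 / s (Suc i)) * (if i = n - 1 then 1 else 0)" if "i < n" for i
    unfolding e_def using that n2 by (subst real_diag_mult_vec_index) auto
  have "0 < (cmod (e $ (n - 1)))\<^sup>2" using ei[of "n - 1"] s_pos[of "n - 1"] n2 by (simp add: norm_divide)
  also have "\<dots> \<le> (vnorm p)\<^sup>2"
    unfolding economy_svd_vnorm[OF svdS SA pc] Vp using n2 by (intro member_le_sum) auto
  finally have p0: "0 < vnorm p" using vnorm_nonneg[of p] by (cases "vnorm p = 0") auto
  show x1: "vnorm x = 1" unfolding x vnorm_smult using p0 by simp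
  have "mat_adjoint V *\<^sub>v x = complex_of_real (1 / vnorm p) \<cdot>\<^sub>v e"
    unfolding x Vp[symmetric] by (rule mult_mat_vec[OF mat_adjoint_carrier[OF V(1)] pc])
  hence "(mat_adjoint V *\<^sub>v x) $ i = 0" if "i < n - 1" for i
    using that e ei[of i] by simp
  thus "(vnorm ((S * A) *\<^sub>v x))\<^sup>2 = (s n)\<^sup>2" using last_right_vector[OF xc] x1 by simp
qed

text \<open>\<open>preconditioned_step\<close> read in reciprocals
  \<open>\<rho> = 1 / \<mu>\<close>, \<open>\<rho>' = 1 / \<mu>'\<close>. The vector
  \<open>z\<close> is the competitor against which the minimizer is later compared.\<close>

lemma rlobpcg_step:
  assumes x: "x \<in> carrier_vec n" and x1: "vnorm x = 1" and \<rho>: "\<rho> = (vnorm (A *\<^sub>v x))\<^sup>2"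
    and gap: "(\<sigma> n)\<^sup>2 < (\<sigma> (n - 1))\<^sup>2" and lt: "\<rho> < (\<sigma> (n - 1))\<^sup>2"
    and q: "q = \<eta> + (1 - \<eta>) * ((\<sigma> n)\<^sup>2 / (\<sigma> (n - 1))\<^sup>2)"
  obtains z a b \<rho>' where "z = complex_of_real a \<cdot>\<^sub>v x + complex_of_real b \<cdot>\<^sub>v rlobpcg_direction A P x"
    "rlobpcg_direction A P x \<in> carrier_vec n" "z \<in> carrier_vec n"
    "0 < vnorm z" "(vnorm (A *\<^sub>v z))\<^sup>2 = \<rho>' * (vnorm z)\<^sup>2" "\<rho>' \<le> \<rho>"
    "(\<rho>' - (\<sigma> n)\<^sup>2) * ((\<sigma> (n - 1))\<^sup>2 - \<rho>) \<le> q\<^sup>2 * ((\<rho> - (\<sigma> n)\<^sup>2) * ((\<sigma> (n - 1))\<^sup>2 - \<rho>'))"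
proof -
  define \<beta> where "\<beta> i = 1 / (\<sigma> (Suc i))\<^sup>2" for i
  have \<sigma>n1: "0 < \<sigma> (n - 1)" using \<sigma>_pos[of "n - 2"] n2 by (simp add: numeral_2_eq_2 Suc_diff_Suc)
  \<comment> \<open>Entry \<open>i\<close> carries \<open>\<sigma> (Suc i)\<close>, so the dominant
    index \<open>n - 1\<close> belongs to \<open>\<sigma> n\<close>.\<close>
  interpret dominant_weight "{..<n}" "n - 1" \<beta> "1 / (\<sigma> n)\<^sup>2" "1 / (\<sigma> (n - 1))\<^sup>2"
  proof
    show "\<beta> i \<le> 1 / (\<sigma> (n - 1))\<^sup>2" if "i \<in> {..<n}" "i \<noteq> n - 1" for i
      unfolding \<beta>_def using that \<sigma>_ge'[of i] \<sigma>n1 by (intro frac_le power_mono) auto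
    show "1 / (\<sigma> (n - 1))\<^sup>2 < 1 / (\<sigma> n)\<^sup>2" using gap \<sigma>n \<sigma>n1 by (intro divide_strict_left_mono) auto
  qed (use n2 \<sigma>n1 in \<open>auto simp: \<beta>_def\<close>)
  \<comment> \<open>The coordinates \<open>\<Sigma> V\<^sup>* z\<close>: in them the norm of
    \<open>A z\<close> is unweighted and that of \<open>z\<close> has weight
    \<open>\<beta>\<close>.\<close>
  define c where "c z i = complex_of_real (\<sigma> (Suc i)) * (mat_adjoint VA *\<^sub>v z) $ i" for z i
  note VA = economy_svd_carrier[OF svd A]
  have VA': "mat_adjoint VA \<in> carrier_mat n n" by (rule mat_adjoint_carrier[OF VA(1)])
  have cA: "Re ((A *\<^sub>v u) \<bullet>c (A *\<^sub>v z)) = wip {..<n} (\<lambda>_. 1) (c u) (c z)"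
    if "u \<in> carrier_vec n" "z \<in> carrier_vec n" for u z
    unfolding economy_svd_Re_cscalar_prod[OF svd A that]
    by (rule wip_cong) (simp add: c_def inner_complex_def power2_eq_square algebra_simps)
  have cI: "Re (u \<bullet>c z) = wip {..<n} \<beta> (c u) (c z)"
    if u: "u \<in> carrier_vec n" and z: "z \<in> carrier_vec n" for u z
  proof -
    have "Re (u \<bullet>c z) = wip {..<n} (\<lambda>_. 1) (coords (mat_adjoint VA *\<^sub>v u)) (coords (mat_adjoint VA *\<^sub>v z))"
      using VA' u z by (simp add: unitary_cscalar_prod[OF VA u z] flip: Re_cscalar_prod)
    also have "\<dots> = wip {..<n} \<beta> (c u) (c z)"
    proof (rule wip_cong)
      fix i assume "i \<in> {..<n}"
      hence "\<sigma> (Suc i) \<noteq> 0" using \<sigma>_pos[of i] by auto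
      thus "1 * inner ((mat_adjoint VA *\<^sub>v u) $ i) ((mat_adjoint VA *\<^sub>v z) $ i) = \<beta> i * inner (c u i) (c z i)"
        by (simp add: \<beta>_def c_def inner_complex_def power2_eq_square field_simps)
    qed
    finally show ?thesis .
  qed
  have clin: "c (complex_of_real a \<cdot>\<^sub>v u + complex_of_real b \<cdot>\<^sub>v z) i = a *\<^sub>R c u i + b *\<^sub>R c z i"
    if "u \<in> carrier_vec n" "z \<in> carrier_vec n" "i < n" for a b u z i
  proof -
    have "mat_adjoint VA *\<^sub>v (complex_of_real a \<cdot>\<^sub>v u + complex_of_real b \<cdot>\<^sub>v z)
      = complex_of_real a \<cdot>\<^sub>v (mat_adjoint VA *\<^sub>v u) + complex_of_real b \<cdot>\<^sub>v (mat_adjoint VA *\<^sub>v z)"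
      using VA' that by (simp add: mult_add_distrib_mat_vec[of _ n n] mult_mat_vec[of _ n n])
    moreover have "mat_adjoint VA *\<^sub>v u \<in> carrier_vec n" "mat_adjoint VA *\<^sub>v z \<in> carrier_vec n"
      using VA' that by auto
    hence "(complex_of_real a \<cdot>\<^sub>v (mat_adjoint VA *\<^sub>v u) + complex_of_real b \<cdot>\<^sub>v (mat_adjoint VA *\<^sub>v z)) $ i
      = complex_of_real a * (mat_adjoint VA *\<^sub>v u) $ i + complex_of_real b * (mat_adjoint VA *\<^sub>v z) $ i"
      using that(3) by (simp only: index_add_vec index_smult_vec carrier_vecD smult_carrier_vec)
    ultimately show ?thesis by (simp add: c_def scaleR_conv_of_real algebra_simps)
  qed
  have Ac: "A *\<^sub>v z \<in> carrier_vec m" if "z \<in> carrier_vec n" for z using A that by simp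
  have nA: "(vnorm (A *\<^sub>v z))\<^sup>2 = wip {..<n} (\<lambda>_. 1) (c z) (c z)"
    and nI: "(vnorm z)\<^sup>2 = wip {..<n} \<beta> (c z) (c z)" if "z \<in> carrier_vec n" for z
    by (simp_all only: vnorm_sq[OF that] vnorm_sq[OF Ac[OF that]] cA[OF that that] cI[OF that that])
  have "(\<sigma> n)\<^sup>2 \<le> \<rho>" using economy_svd_vnorm_ge[OF svd A x] by (simp add: x1 \<rho>)
  moreover have "0 < (\<sigma> n)\<^sup>2" using \<sigma>n by simp
  ultimately have \<rho>0: "0 < \<rho>" by linarith
  define \<mu> where "\<mu> = 1 / \<rho>"
  define g where "g = mat_adjoint A *\<^sub>v (A *\<^sub>v x) - complex_of_real \<rho> \<cdot>\<^sub>v x"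
  have AAx: "mat_adjoint A *\<^sub>v (A *\<^sub>v x) \<in> carrier_vec n" using mat_adjoint_carrier[OF A] Ac[OF x] by simp
  have g: "g \<in> carrier_vec n" using AAx x by (simp add: g_def)
  define w where "w = rlobpcg_direction A P x"
  have w_eq: "w = P *\<^sub>v (mat_adjoint P *\<^sub>v g)" by (simp add: w_def rlobpcg_direction_def g_def \<rho>)
  note inv = preconditioner_inverse[OF svdS SA _ P g]
  have w: "w \<in> carrier_vec n" unfolding w_eq by (rule inv(1)[OF _ x]) (rule s_pos)
  \<comment> \<open>In these coordinates \<open>g\<close> is represented by
    \<open>- \<rho> * (\<beta> - \<mu>) * c x\<close>. Multiplying by \<open>\<kappa>\<close>, which
    is \<open>- 1 / (\<rho> * sqrt \<rho>)\<close>, gives the residual \<open>r\<close> of the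
    normalized vector \<open>y\<close>.\<close>
  define \<kappa> where "\<kappa> = - (\<mu> / sqrt \<rho>)"
  define av where "av = complex_of_real \<kappa> \<cdot>\<^sub>v w"
  have av: "av \<in> carrier_vec n" using w by (simp add: av_def)
  define y where "y i = (1 / sqrt \<rho>) *\<^sub>R c x i" for i
  define r where "r = (\<lambda>i. (\<beta> i - \<mu>) *\<^sub>R y i)"
  have dual: "Re (((S * A) *\<^sub>v av) \<bullet>c ((S * A) *\<^sub>v z)) = wip {..<n} (\<lambda>_. 1) r (c z)"
    if z: "z \<in> carrier_vec n" for z
  proof -
    have "(S * A) *\<^sub>v av = complex_of_real \<kappa> \<cdot>\<^sub>v ((S * A) *\<^sub>v w)"
      unfolding av_def by (rule mult_mat_vec[OF SA w])
    moreover have SAv: "(S * A) *\<^sub>v w \<in> carrier_vec d" "(S * A) *\<^sub>v z \<in> carrier_vec d"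
      using mult_mat_vec_carrier[OF SA] w z by auto
    ultimately have "Re (((S * A) *\<^sub>v av) \<bullet>c ((S * A) *\<^sub>v z)) = \<kappa> * Re (((S * A) *\<^sub>v w) \<bullet>c ((S * A) *\<^sub>v z))"
      by (simp only: smult_scalar_prod_distrib[of _ d] carrier_vec_conjugate) simp
    also have "\<dots> = \<kappa> * Re (g \<bullet>c z)" unfolding w_eq by (subst inv(2)[OF _ z]) (auto simp: s_pos)
    also have "Re (g \<bullet>c z) = Re ((A *\<^sub>v x) \<bullet>c (A *\<^sub>v z)) - \<rho> * Re (x \<bullet>c z)"
    proof -
      have "(mat_adjoint A *\<^sub>v (A *\<^sub>v x)) \<bullet>c z = conjugate (z \<bullet>c (mat_adjoint A *\<^sub>v (A *\<^sub>v x)))"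
        using conjugate_conjugate_sprod[OF AAx z] conjugate_vec_sprod_comm[OF z AAx] by (metis conjugate_id)
      also have "\<dots> = conjugate ((A *\<^sub>v z) \<bullet>c (A *\<^sub>v x))"
        by (simp only: cscalar_prod_adjoint[OF A z Ac[OF x]])
      finally have "Re ((mat_adjoint A *\<^sub>v (A *\<^sub>v x)) \<bullet>c z) = Re ((A *\<^sub>v z) \<bullet>c (A *\<^sub>v x))" by simp
      also have "\<dots> = Re ((A *\<^sub>v x) \<bullet>c (A *\<^sub>v z))"
        using x z by (simp only: cA wip_commute)
      finally have 1: "Re ((mat_adjoint A *\<^sub>v (A *\<^sub>v x)) \<bullet>c z) = Re ((A *\<^sub>v x) \<bullet>c (A *\<^sub>v z))" .
      have "g \<bullet>c z = (mat_adjoint A *\<^sub>v (A *\<^sub>v x)) \<bullet>c z - complex_of_real \<rho> * (x \<bullet>c z)"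
        unfolding g_def using AAx x z
        by (simp add: minus_scalar_prod_distrib[of _ n] smult_scalar_prod_distrib[of _ n])
      thus ?thesis by (simp add: 1)
    qed
    also have "\<kappa> * (Re ((A *\<^sub>v x) \<bullet>c (A *\<^sub>v z)) - \<rho> * Re (x \<bullet>c z))
      = (1 / sqrt \<rho>) * (wip {..<n} \<beta> (c x) (c z) - \<mu> * wip {..<n} (\<lambda>_. 1) (c x) (c z))"
      unfolding cA[OF x z] cI[OF x z] \<kappa>_def \<mu>_def using \<rho>0 by (simp add: field_simps)
    also have "\<dots> = wip {..<n} (\<lambda>_. 1) r (c z)"
      unfolding wip_def sum_distrib_left sum_subtractf[symmetric]
      by (rule sum.cong) (simp_all add: r_def y_def algebra_simps diff_divide_distrib)
    finally show ?thesis .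
  qed
  have res: "wip {..<n} (\<lambda>_. 1) (\<lambda>i. r i - c av i) (\<lambda>i. r i - c av i)
      \<le> \<eta>\<^sup>2 * wip {..<n} (\<lambda>_. 1) (c av) (c av)"
    by (rule embedding_dual_bound[OF A S svd \<sigma>_pos emb \<eta>(1) c_def av dual])
  have ysc: "wip {..<n} v y y = wip {..<n} v (c x) (c x) / \<rho>" for v
    using \<rho>0 unfolding wip_def sum_divide_distrib by (intro sum.cong) (auto simp: y_def)
  have y1: "wip {..<n} (\<lambda>_. 1) y y = 1" using \<rho>0 by (simp add: ysc \<rho> flip: nA[OF x])
  have y\<mu>: "\<mu> = wip {..<n} \<beta> y y" by (simp add: ysc x1 \<mu>_def flip: nI[OF x])
  have \<mu>gt: "1 / (\<sigma> (n - 1))\<^sup>2 < \<mu>"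
    unfolding \<mu>_def using lt \<rho>0 \<sigma>n1 by (intro divide_strict_left_mono) auto
  have q': "q = \<eta> + (1 - \<eta>) * ((1 / (\<sigma> (n - 1))\<^sup>2) / (1 / (\<sigma> n)\<^sup>2))" by (simp add: q)
  define p where "p = (\<lambda>i. \<mu> *\<^sub>R y i + (1 - \<eta>\<^sup>2) *\<^sub>R c av i)"
  define \<mu>' where "\<mu>' = wip {..<n} \<beta> p p / wip {..<n} (\<lambda>_. 1) p p"
  note st = preconditioned_step[OF y1 y\<mu> \<mu>gt \<eta> q' r_def res p_def \<mu>'_def]
  define a b where "a = \<mu> / sqrt \<rho>" and "b = (1 - \<eta>\<^sup>2) * \<kappa>"
  define z where "z = complex_of_real a \<cdot>\<^sub>v x + complex_of_real b \<cdot>\<^sub>v w"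
  have z: "z \<in> carrier_vec n" using x w by (simp add: z_def)
  have cav: "c av i = \<kappa> *\<^sub>R c w i" if "i < n" for i
    using VA' w that unfolding c_def av_def
    by (subst mult_mat_vec[OF VA' w]) (simp add: scaleR_conv_of_real)
  have cz: "c z i = p i" if "i < n" for i
    unfolding z_def clin[OF x w that] by (simp add: p_def cav[OF that] y_def a_def b_def)
  have pp: "wip {..<n} v (c z) (c z) = wip {..<n} v p p" for v
    by (rule wip_cong) (simp add: cz)
  have \<mu>0: "0 < \<mu>" using \<rho>0 by (simp add: \<mu>_def)
  have \<mu>'0: "0 < \<mu>'" using \<mu>0 st(2) by linarith
  have nz: "(vnorm z)\<^sup>2 = \<mu>' * (vnorm (A *\<^sub>v z))\<^sup>2"
    unfolding nA[OF z] nI[OF z] pp \<mu>'_def using st(1) by simp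
  have zpos: "0 < vnorm z"
  proof -
    have "0 < (vnorm z)\<^sup>2" unfolding nz unfolding nA[OF z] pp using \<mu>'0 st(1) by simp
    thus ?thesis using vnorm_nonneg[of z] by (cases "vnorm z = 0") auto
  qed
  define \<rho>' where "\<rho>' = 1 / \<mu>'"
  have \<rho>'0: "0 < \<rho>'" using \<mu>'0 by (simp add: \<rho>'_def)
  have le: "\<rho>' \<le> \<rho>" using st(2) \<mu>0 \<mu>'0 unfolding \<rho>'_def \<mu>_def by (simp add: field_simps)
  have "(\<rho>' - (\<sigma> n)\<^sup>2) * ((\<sigma> (n - 1))\<^sup>2 - \<rho>) \<le> q\<^sup>2 * ((\<rho> - (\<sigma> n)\<^sup>2) * ((\<sigma> (n - 1))\<^sup>2 - \<rho>'))"
  proof -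
    \<comment> \<open>Multiplying by \<open>K\<close>, the product of the four quantities, clears
      all reciprocals on both sides at once.\<close>
    have inv: "K * ((1 / l1 - 1 / t) * (1 / u - 1 / l2)) = (t - l1) * (l2 - u)"
      if "K = l1 * l2 * t * u" "0 < l1" "0 < l2" "0 < t" "0 < u" for K l1 l2 t u :: real
      using that by (simp add: field_simps)
    define K where "K = (\<sigma> n)\<^sup>2 * (\<sigma> (n - 1))\<^sup>2 * \<rho> * \<rho>'"
    have l: "0 < (\<sigma> n)\<^sup>2" "0 < (\<sigma> (n - 1))\<^sup>2" using \<sigma>n \<sigma>n1 by auto
    have K0: "0 < K" using l \<rho>0 \<rho>'0 by (simp add: K_def)
    have "\<mu>' = 1 / \<rho>'" by (simp add: \<rho>'_def)
    hence "K * ((1 / (\<sigma> n)\<^sup>2 - 1 / \<rho>') * (1 / \<rho> - 1 / (\<sigma> (n - 1))\<^sup>2))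
      \<le> K * (q\<^sup>2 * ((1 / (\<sigma> n)\<^sup>2 - 1 / \<rho>) * (1 / \<rho>' - 1 / (\<sigma> (n - 1))\<^sup>2)))"
      using st(3) K0 by (intro mult_left_mono) (auto simp: \<mu>_def)
    also have "\<dots> = q\<^sup>2 * (K * ((1 / (\<sigma> n)\<^sup>2 - 1 / \<rho>) * (1 / \<rho>' - 1 / (\<sigma> (n - 1))\<^sup>2)))"
      by (simp only: ac_simps)
    also have "K * ((1 / (\<sigma> n)\<^sup>2 - 1 / \<rho>) * (1 / \<rho>' - 1 / (\<sigma> (n - 1))\<^sup>2)) = (\<rho> - (\<sigma> n)\<^sup>2) * ((\<sigma> (n - 1))\<^sup>2 - \<rho>')"
      by (rule inv) (use l \<rho>0 \<rho>'0 in \<open>auto simp: K_def\<close>)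
    also have "K * ((1 / (\<sigma> n)\<^sup>2 - 1 / \<rho>') * (1 / \<rho> - 1 / (\<sigma> (n - 1))\<^sup>2)) = (\<rho>' - (\<sigma> n)\<^sup>2) * ((\<sigma> (n - 1))\<^sup>2 - \<rho>)"
      by (rule inv) (use l \<rho>0 \<rho>'0 in \<open>auto simp: K_def\<close>)
    finally show ?thesis .
  qed
  moreover have "(vnorm (A *\<^sub>v z))\<^sup>2 = \<rho>' * (vnorm z)\<^sup>2" unfolding nz \<rho>'_def using \<mu>'0 by simp
  ultimately show thesis using that[of z a b \<rho>'] z w zpos le by (simp add: z_def w_def)
qed

text \<open>Because of the gap, \<open>vmin\<close> has only its last \<open>VA\<close>-coordinate
  nonzero. So the cosine is the modulus of that coordinate of \<open>x\<close>, and the rest of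
  \<open>x\<close> is stretched by at least \<open>\<sigma> (n - 1)\<close>.\<close>

lemma cosine_bounds:
  assumes vmin: "unit_right_singular_vector A (\<sigma> n) vmin" and gap: "(\<sigma> n)\<^sup>2 < (\<sigma> (n - 1))\<^sup>2"
    and x: "x \<in> carrier_vec n" and x1: "vnorm x = 1"
  shows "vmin \<in> carrier_vec n" "(vnorm (A *\<^sub>v vmin))\<^sup>2 = (\<sigma> n)\<^sup>2" "cmod (x \<bullet>c vmin) \<le> 1"
    "(\<sigma> n)\<^sup>2 * (cmod (x \<bullet>c vmin))\<^sup>2 + (\<sigma> (n - 1))\<^sup>2 * (1 - (cmod (x \<bullet>c vmin))\<^sup>2) \<le> (vnorm (A *\<^sub>v x))\<^sup>2"
proof -
  obtain u where v: "vmin \<in> carrier_vec n" and v1: "vnorm vmin = 1" and u1: "vnorm u = 1"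
    and Av: "A *\<^sub>v vmin = complex_of_real (\<sigma> n) \<cdot>\<^sub>v u"
    using vmin A by (auto simp: unit_right_singular_vector_def)
  show "vmin \<in> carrier_vec n" by (fact v)
  show Av2: "(vnorm (A *\<^sub>v vmin))\<^sup>2 = (\<sigma> n)\<^sup>2" by (simp add: Av vnorm_smult u1)
  note VA = economy_svd_carrier[OF svd A]
  have VA': "mat_adjoint VA \<in> carrier_mat n n" by (rule mat_adjoint_carrier[OF VA(1)])
  define f where "f = mat_adjoint VA *\<^sub>v vmin"
  define g where "g = mat_adjoint VA *\<^sub>v x"
  have fg: "f \<in> carrier_vec n" "g \<in> carrier_vec n" using VA' v x by (auto simp: f_def g_def)
  note nv = economy_svd_vnorm[OF svd A v, folded f_def] and nx = economy_svd_vnorm[OF svd A x, folded g_def]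
  \<comment> \<open>\<open>vmin\<close> attains the minimal stretching, so a sum of nonnegative
    terms vanishes.\<close>
  have "(\<Sum>i<n. ((\<sigma> (Suc i))\<^sup>2 - (\<sigma> n)\<^sup>2) * (cmod (f $ i))\<^sup>2) = 0"
    using nv Av2 v1 by (simp add: left_diff_distrib sum_subtractf flip: sum_distrib_left)
  moreover have "0 \<le> ((\<sigma> (Suc i))\<^sup>2 - (\<sigma> n)\<^sup>2) * (cmod (f $ i))\<^sup>2" if "i \<in> {..<n}" for i
    using \<sigma>_ge[of i] that \<sigma>n by (intro mult_nonneg_nonneg) (auto intro: power_mono)
  ultimately have terms: "((\<sigma> (Suc i))\<^sup>2 - (\<sigma> n)\<^sup>2) * (cmod (f $ i))\<^sup>2 = 0" if "i < n" for i
    using sum_nonneg_eq_0_iff[of "{..<n}" "\<lambda>i. ((\<sigma> (Suc i))\<^sup>2 - (\<sigma> n)\<^sup>2) * (cmod (f $ i))\<^sup>2"] that by auto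
  have \<sigma>n1: "0 < \<sigma> (n - 1)" using \<sigma>_pos[of "n - 2"] n2 by (simp add: numeral_2_eq_2 Suc_diff_Suc)
  have sq: "(\<sigma> (n - 1))\<^sup>2 \<le> (\<sigma> (Suc i))\<^sup>2" if "i < n - 1" for i
    using \<sigma>_ge'[OF that] \<sigma>n1 by (intro power_mono) auto
  have f0: "f $ i = 0" if "i < n - 1" for i
    using terms[of i] sq[OF that] gap that by auto
  have last: "{..<n} = insert (n - 1) {..<n - 1}" using n2 by auto
  have fl: "cmod (f $ (n - 1)) = 1"
  proof -
    have "(cmod (f $ (n - 1)))\<^sup>2 = 1" using nv(1) v1 f0 by (simp add: last)
    thus ?thesis by (metis abs_norm_cancel abs_square_eq_1)
  qed
  have "x \<bullet>c vmin = g \<bullet>c f" unfolding f_def g_def by (rule unitary_cscalar_prod[OF VA x v, symmetric])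
  also have "\<dots> = (\<Sum>i<n. g $ i * cnj (f $ i))"
    using fg by (simp add: scalar_prod_def lessThan_atLeast0)
  also have "\<dots> = g $ (n - 1) * cnj (f $ (n - 1))" using f0 by (simp add: last)
  finally have c: "cmod (x \<bullet>c vmin) = cmod (g $ (n - 1))" using fl by (simp add: norm_mult)
  define T where "T = (\<Sum>i<n - 1. (cmod (g $ i))\<^sup>2)"
  have T: "(cmod (g $ (n - 1)))\<^sup>2 + T = 1" using nx(1) x1 by (simp add: last T_def)
  have "0 \<le> T" by (simp add: T_def sum_nonneg)
  hence "(cmod (g $ (n - 1)))\<^sup>2 \<le> 1\<^sup>2" using T by simp
  thus "cmod (x \<bullet>c vmin) \<le> 1" unfolding c by (rule power2_le_imp_le) simp
  have "(\<sigma> (n - 1))\<^sup>2 * T \<le> (\<Sum>i<n - 1. (\<sigma> (Suc i))\<^sup>2 * (cmod (g $ i))\<^sup>2)"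
    unfolding T_def sum_distrib_left by (intro sum_mono mult_right_mono) (use sq in auto)
  moreover have "(vnorm (A *\<^sub>v x))\<^sup>2 = (\<sigma> n)\<^sup>2 * (cmod (g $ (n - 1)))\<^sup>2 + (\<Sum>i<n - 1. (\<sigma> (Suc i))\<^sup>2 * (cmod (g $ i))\<^sup>2)"
    unfolding nx(2) last using n2 by simp
  moreover have "T = 1 - (cmod (g $ (n - 1)))\<^sup>2" using T by simp
  ultimately show "(\<sigma> n)\<^sup>2 * (cmod (x \<bullet>c vmin))\<^sup>2 + (\<sigma> (n - 1))\<^sup>2 * (1 - (cmod (x \<bullet>c vmin))\<^sup>2) \<le> (vnorm (A *\<^sub>v x))\<^sup>2"
    unfolding c by simp
qed

end

section \<open>Convergence of the iteration\<close>

theorem theorem1p2: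
  fixes A S :: "complex mat" and m n d k :: nat and \<sigma> :: "nat \<Rightarrow> real"
    and \<eta> gap C q :: real and vmin :: "complex vec" and v :: "nat \<Rightarrow> complex vec"
  assumes "A \<in> carrier_mat m n" and "2 \<le> n" and "n \<le> m"
    and "singular_values A \<sigma>" and "0 < \<sigma> n"
    and "S \<in> carrier_mat d m" and "0 \<le> \<eta>" and "\<eta> < 1" and "subspace_embedding S A \<eta>"
    and "gap = ((\<sigma> (n - 1))\<^sup>2 - (\<sigma> n)\<^sup>2) / (\<sigma> n)\<^sup>2"
    and "\<eta> < gap / (2 + gap)"
    and "unit_right_singular_vector A (\<sigma> n) vmin"
    and "rlobpcg A S v"
    and "C = 2 * \<eta> / ((1 - \<eta>) * gap - 2 * \<eta>)"
    and "q = \<eta> + (1 - \<eta>) / (1 + gap)"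
  shows "((vnorm (A *\<^sub>v v k))\<^sup>2 - (\<sigma> n)\<^sup>2) / (\<sigma> n)\<^sup>2 \<le> C * gap * q ^ (2 * k)
       \<and> \<bar>sin (vangle (v k) vmin)\<bar> \<le> \<bar>tan (vangle (v k) vmin)\<bar>
       \<and> \<bar>tan (vangle (v k) vmin)\<bar> \<le> sqrt C * q ^ k"
proof -
  have An: "dim_col A = n" and SAc: "S * A \<in> carrier_mat d n" using assms(1,6) by auto
  obtain UA VA where svd: "economy_svd A UA \<sigma> VA" using assms(4) by (auto simp: singular_values_def)
  obtain U s V where svdS: "economy_svd (S * A) U s V"
    and v0: "v 0 = complex_of_real (1 / vnorm ((V * real_diag n (\<lambda>i. 1 / s i)) *\<^sub>v unit_vec n (n - 1)))
      \<cdot>\<^sub>v ((V * real_diag n (\<lambda>i. 1 / s i)) *\<^sub>v unit_vec n (n - 1))"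
    and vSuc: "\<And>i. is_arg_min (\<lambda>z. vnorm (A *\<^sub>v z))
      (\<lambda>z. z \<in> cspan n {v (i - 1), v i, rlobpcg_direction A (V * real_diag n (\<lambda>i. 1 / s i)) (v i)} \<and> vnorm z = 1)
      (v (Suc i))"
    using assms(13) by (auto simp: rlobpcg_def Let_def An)
  define P where "P = V * real_diag n (\<lambda>i. 1 / s i)"
  interpret embedded_svd A S UA VA U V P m n d \<sigma> s \<eta>
    by unfold_locales (fact assms svd svdS P_def)+
  define l1 l2 where "l1 = (\<sigma> n)\<^sup>2" and "l2 = (\<sigma> (n - 1))\<^sup>2"
  define \<rho> where "\<rho> i = (vnorm (A *\<^sub>v v i))\<^sup>2" for i
  have l1: "0 < l1" using assms(5) by (simp add: l1_def)
  have gapl: "l2 = (1 + gap) * l1" using l1 by (simp add: assms(10) l1_def l2_def field_simps)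
  have "\<sigma> n \<le> \<sigma> (n - 1)" using economy_svd_mono(1)[OF svd assms(1), of "n - 1" n] assms(2) by simp
  hence "0 \<le> gap" unfolding assms(10) using assms(5) by (intro divide_nonneg_nonneg) (auto intro: power_mono)
  moreover have "gap \<noteq> 0" using assms(7,11) by auto
  ultimately have gap0: "0 < gap" by simp
  have l12: "l1 < l2" unfolding gapl using gap0 l1 by simp
  \<comment> \<open>The hypothesis on \<open>\<eta>\<close> is exactly the positivity of the
    denominator of \<open>C\<close>.\<close>
  have Cden: "0 < (1 - \<eta>) * gap - 2 * \<eta>"
    using assms(11) gap0 by (simp add: field_simps)
  have C0: "0 \<le> C" using Cden assms(7) by (simp add: assms(14))
  have q: "q = \<eta> + (1 - \<eta>) * ((\<sigma> n)\<^sup>2 / (\<sigma> (n - 1))\<^sup>2)"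
    unfolding l1_def[symmetric] l2_def[symmetric] gapl using l1 by (simp add: assms(15))
  have q0: "0 \<le> q" using assms(7,8,15) gap0 by simp
  have ge_l1: "l1 \<le> (vnorm (A *\<^sub>v x))\<^sup>2" if "x \<in> carrier_vec n" "vnorm x = 1" for x
    using economy_svd_vnorm_ge[OF svd assms(1) that(1)] that(2) by (simp add: l1_def)
  have gap': "(\<sigma> n)\<^sup>2 < (\<sigma> (n - 1))\<^sup>2" using l12 by (simp add: l1_def l2_def)
  \<comment> \<open>The contracted ratio \<open>(\<rho> - l1) / (l2 - \<rho>)\<close> is kept
    multiplied out. The last conjunct makes the whole search space well-formed; at
    \<open>i = 0\<close> it concerns \<open>v 0\<close> again.\<close>
  have inv: "v i \<in> carrier_vec n \<and> vnorm (v i) = 1 \<and> \<rho> i < l2 \<and> \<rho> i - l1 \<le> C * q ^ (2 * i) * (l2 - \<rho> i)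
     \<and> v (i - 1) \<in> carrier_vec n" for i
  proof (induction i)
    case 0
    note start = initial_vector[OF refl v0[folded P_def]]
    have vmin: "vmin \<in> carrier_vec n" "(vnorm (A *\<^sub>v vmin))\<^sup>2 = l1"
      using cosine_bounds[OF assms(12) gap' start(1,2)] by (auto simp: l1_def)
    \<comment> \<open>The start minimizes the sketched norm over unit vectors. Comparing with
      \<open>vmin\<close> through both embedding bounds gives \<open>(1 - \<eta>) * \<rho> 0 \<le>
      (s n)\<^sup>2 \<le> (1 + \<eta>) * l1\<close>.\<close>
    have "vnorm vmin = 1" using assms(12) by (auto simp: unit_right_singular_vector_def)
    hence "(s n)\<^sup>2 \<le> (1 + \<eta>) * l1"
      using economy_svd_vnorm_ge[OF svdS SAc vmin(1)] embedding(2)[OF vmin(1)] vmin(2) by simp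
    hence "(1 - \<eta>) * \<rho> 0 \<le> (1 + \<eta>) * l1"
      using embedding(1)[OF start(1)] start(3) by (simp add: \<rho>_def)
    hence b: "(1 - \<eta>) * (\<rho> 0 - l1) \<le> 2 * \<eta> * l1" by (simp add: algebra_simps)
    have e: "(1 - \<eta>) * (l2 - \<rho> 0) = (1 - \<eta>) * gap * l1 - (1 - \<eta>) * (\<rho> 0 - l1)"
      by (simp add: gapl algebra_simps)
    have b2: "((1 - \<eta>) * gap - 2 * \<eta>) * l1 \<le> (1 - \<eta>) * (l2 - \<rho> 0)"
      unfolding e using b by (simp add: algebra_simps)
    moreover have "0 < ((1 - \<eta>) * gap - 2 * \<eta>) * l1" using Cden l1 by simp
    ultimately have "0 < (1 - \<eta>) * (l2 - \<rho> 0)" by linarith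
    hence lt: "\<rho> 0 < l2" using assms(8) by (simp add: zero_less_mult_iff)
    \<comment> \<open>\<open>C\<close> is the quotient of the upper bound
      \<open>2 * \<eta> * l1\<close> for \<open>(1 - \<eta>) * (\<rho> 0 - l1)\<close> and the lower
      bound \<open>b2\<close> for \<open>(1 - \<eta>) * (l2 - \<rho> 0)\<close>.\<close>
    have "C * (((1 - \<eta>) * gap - 2 * \<eta>) * l1) \<le> C * ((1 - \<eta>) * (l2 - \<rho> 0))"
      using b2 C0 by (rule mult_left_mono)
    moreover have "C * (((1 - \<eta>) * gap - 2 * \<eta>) * l1) = 2 * \<eta> * l1" using Cden by (simp add: assms(14))
    ultimately have "(1 - \<eta>) * (\<rho> 0 - l1) \<le> (1 - \<eta>) * (C * (l2 - \<rho> 0))"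
      using b by (simp add: mult.left_commute)
    hence "\<rho> 0 - l1 \<le> C * (l2 - \<rho> 0)" using assms(8) by simp
    thus ?case using start lt by simp
  next
    case (Suc i)
    let ?w = "rlobpcg_direction A P (v i)"
    let ?X = "{v (i - 1), v i, ?w}"
    have lt: "\<rho> i < (\<sigma> (n - 1))\<^sup>2" using Suc by (simp add: l2_def)
    obtain z a b \<rho>' where z: "z = complex_of_real a \<cdot>\<^sub>v v i + complex_of_real b \<cdot>\<^sub>v ?w"
      and w: "?w \<in> carrier_vec n" and zc: "z \<in> carrier_vec n"
      and zpos: "0 < vnorm z" and Az: "(vnorm (A *\<^sub>v z))\<^sup>2 = \<rho>' * (vnorm z)\<^sup>2" and le: "\<rho>' \<le> \<rho> i"
      and contr: "(\<rho>' - l1) * (l2 - \<rho> i) \<le> q\<^sup>2 * ((\<rho> i - l1) * (l2 - \<rho>'))"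
      using rlobpcg_step[OF _ _ \<rho>_def gap' lt q] Suc unfolding l1_def l2_def by blast
    have X: "?X \<subseteq> carrier_vec n" using Suc w by simp
    have arg: "v (Suc i) \<in> cspan n ?X" "vnorm (v (Suc i)) = 1"
      and min: "\<And>t. t \<in> cspan n ?X \<Longrightarrow> vnorm t = 1 \<Longrightarrow> vnorm (A *\<^sub>v v (Suc i)) \<le> vnorm (A *\<^sub>v t)"
      using vSuc[of i, folded P_def] by (auto simp: is_arg_min_def not_less)
    have vc: "v (Suc i) \<in> carrier_vec n" by (rule cspan_carrier[OF X arg(1)])
    \<comment> \<open>The normalized competitor lies in the search space, so the minimizer does at
      least as well.\<close>
    define t where "t = complex_of_real (1 / vnorm z) \<cdot>\<^sub>v z"
    have t_eq: "t = (complex_of_real (1 / vnorm z) * complex_of_real a) \<cdot>\<^sub>v v i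
        + (complex_of_real (1 / vnorm z) * complex_of_real b) \<cdot>\<^sub>v ?w"
      unfolding t_def z using Suc w by (simp add: smult_add_distrib_vec[of _ n] smult_smult_assoc)
    have "t \<in> cspan n ?X" unfolding t_eq by (rule cspan_lincomb[OF X]) auto
    moreover have "vnorm t = 1" unfolding t_def vnorm_smult using zpos by simp
    ultimately have "vnorm (A *\<^sub>v v (Suc i)) \<le> vnorm (A *\<^sub>v t)" by (rule min)
    hence "\<rho> (Suc i) \<le> (vnorm (A *\<^sub>v t))\<^sup>2" unfolding \<rho>_def by (intro power_mono vnorm_nonneg)
    also have "A *\<^sub>v t = complex_of_real (1 / vnorm z) \<cdot>\<^sub>v (A *\<^sub>v z)"
      unfolding t_def by (rule mult_mat_vec[OF assms(1) zc])
    also have "(vnorm \<dots>)\<^sup>2 = \<rho>'" unfolding vnorm_smult using zpos Az by (simp add: power_mult_distrib power_divide)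
    finally have le': "\<rho> (Suc i) \<le> \<rho>'" .
    have lt': "\<rho>' < l2" using le Suc by simp
    have g0: "0 < l2 - \<rho> i" using Suc by simp
    \<comment> \<open>Insert the induction hypothesis into the contraction and cancel
      \<open>l2 - \<rho> i\<close>; lowering \<open>\<rho>'\<close> to \<open>\<rho> (Suc i)\<close>
      then only strengthens the estimate.\<close>
    have "(\<rho>' - l1) * (l2 - \<rho> i) \<le> q\<^sup>2 * ((C * q ^ (2 * i) * (l2 - \<rho> i)) * (l2 - \<rho>'))"
      using Suc lt' by (intro order.trans[OF contr] mult_left_mono mult_right_mono) auto
    hence "(\<rho>' - l1) * (l2 - \<rho> i) \<le> (C * q ^ (2 * Suc i) * (l2 - \<rho>')) * (l2 - \<rho> i)"
      by (simp add: power2_eq_square ac_simps)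
    hence "\<rho>' - l1 \<le> C * q ^ (2 * Suc i) * (l2 - \<rho>')" using g0 by (rule mult_right_le_imp_le)
    also have "\<dots> \<le> C * q ^ (2 * Suc i) * (l2 - \<rho> (Suc i))"
      using le' C0 q0 by (intro mult_left_mono) auto
    finally have "\<rho> (Suc i) - l1 \<le> C * q ^ (2 * Suc i) * (l2 - \<rho> (Suc i))" using le' by simp
    thus ?case using vc arg(2) le' lt' Suc by simp
  qed
  have vk: "v k \<in> carrier_vec n" "vnorm (v k) = 1" and lt: "\<rho> k < l2"
    and bound: "\<rho> k - l1 \<le> C * q ^ (2 * k) * (l2 - \<rho> k)"
    using inv[of k] by auto
  define K where "K = C * q ^ (2 * k)"
  have K0: "0 \<le> K" using C0 q0 by (simp add: K_def)
  \<comment> \<open>Since \<open>\<rho> k \<ge> l1\<close>, the factor \<open>l2 - \<rho> k\<close>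
    is at most \<open>l2 - l1 = gap * l1\<close>.\<close>
  have "\<rho> k - l1 \<le> K * (l2 - l1)"
    using bound ge_l1[OF vk] K0 unfolding K_def[symmetric] \<rho>_def
    by (meson diff_left_mono mult_left_mono order_trans)
  hence first: "(\<rho> k - l1) / l1 \<le> C * gap * q ^ (2 * k)"
    using l1 by (simp add: pos_divide_le_eq K_def gapl algebra_simps)
  note cb = cosine_bounds(3,4)[OF assms(12) gap' vk, folded l1_def l2_def \<rho>_def]
  note ab = angle_bounds[OF norm_ge_zero cb(1) l12 lt bound[folded K_def] K0 cb(2)]
  have "sqrt K = sqrt C * q ^ k"
    using q0 by (simp add: K_def real_sqrt_mult power_even_eq)
  thus ?thesis using first ab by (simp add: vangle_def \<rho>_def l1_def)
qed

end
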